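(* Let $1<p\le 2$. There is an absolute constant $C_3$ such that $$ \sup_{r>0}\frac{E_p(r)}{r^{2/3}}\le\frac{C_3}{\sqrt{p-1}}. $$
   Context: For $p\ge1$, $B_p=\{(x,y)\in\mathbb{R}^2:|x|^p+|y|^p\le 1\}$. For $r>0$, $N_p(r)$ is the number of points of $\mathbb{Z}^2$ lying in $rB_p=\{r\boldsymbol{x}:\boldsymbol{x}\in B_p\}$, and the lattice point discrepancy is $E_p(r)=|N_p(r)-\mathrm{area}(B_p)\,r^2|$. "Absolute constant" means a constant independent of all parameters, in particular of $p$ and $r$.
   Formalization: The supremum is taken over r ≥ 1 instead of r > 0, because for small r only the origin lies in rB_p, so E_p(r) tends to 1 and E_p(r)/r^{2/3} is unbounded as r tends to 0. *)

theory Defs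
  imports "HOL-Analysis.Analysis"
begin

definition Bp :: "real \<Rightarrow> (real \<times> real) set" where
  "Bp p = {(x, y). \<bar>x\<bar> powr p + \<bar>y\<bar> powr p \<le> 1}"

definition lattice_count :: "real \<Rightarrow> real \<Rightarrow> nat" where
  "lattice_count p r = card ((\<int> \<times> \<int>) \<inter> (\<lambda>v. r *\<^sub>R v) ` Bp p)"

definition discrepancy :: "real \<Rightarrow> real \<Rightarrow> real" where
  "discrepancy p r = \<bar>real (lattice_count p r) - measure lborel (Bp p) * r\<^sup>2\<bar>"

end

theory Submission
  imports Defs "HOL-Real_Asymp.Real_Asymp"
begin

text \<open>
  Counting columns up to the diagonal and comparing the sum of the heights with the area by the
  trapezoid rule reduces the discrepancy, up to $O(1)$, to the sum of $\psi(F(n))$ over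
  $1 \le n \le r 2^{-1/p}$, where $\psi(y) = \{y\} - 1/2$ and $F(x) = (r^p - x^p)^{1/p}$.
  Averaging over a shift of length $\eta = 1/H$ bounds $\psi$ on both sides by difference
  quotients of the second Bernoulli function, whose Fourier coefficients are $O(1/h^2)$. This leaves
  exponential sums $\sum_n e(h F(n))$. Since $F'$ stays in $[-1, 0]$ and decreases at rate at least
  $(p-1)/r$, the Kusmin--Landau inequality bounds them by $O(\sqrt{h r/(p-1)})$, and summing over
  $h$ gives $O(r/H + \sqrt{H r/(p-1)})$. The choice $H \approx r^{1/3}$ gives the claim.
\<close>

section \<open>The Fourier series of the second Bernoulli function\<close>

text \<open>Two singularities shape the argument. At x = r the tangent is vertical, so columns are
  only used up to the diagonal; the rest of the ball is the mirror image, and the overlap is a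
  square. For 1 < p < 2 the second derivative of F is unbounded as x tends to 0, so an estimate that
  wants the curvature between two comparable bounds would not be uniform in p. Here the curvature
  enters only through its lower bound (p-1)/r, and that bound is the one source of 1/sqrt(p-1). The
  other input is the slope range [0,1]: the differences of the phase h F meet at most h + 1 integer
  cells. The Fourier expansion is applied to the second Bernoulli function because the exponential
  sums grow like sqrt(h). Coefficients 1/h^2 leave the convergent series of h^(-3/2), while the
  coefficients 1/h of the sawtooth itself would leave a divergent one.\<close>

lemma dirichlet_kernel:
  fixes y :: real
  shows "2 * sin (pi * y) * (1 / 2 + (\<Sum>h<N. cos (2 * pi * real (Suc h) * y)))
    = sin (pi * (2 * real N + 1) * y)"
proof (induction N)
  case (Suc N)
  have "2 * sin (pi * y) * cos (2 * pi * real (Suc N) * y)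
      = sin (pi * (2 * real (Suc N) + 1) * y) - sin (pi * (2 * real N + 1) * y)"
  proof -
    have "pi * (2 * real (Suc N) + 1) * y = 2 * pi * real (Suc N) * y + pi * y"
      "pi * (2 * real N + 1) * y = 2 * pi * real (Suc N) * y - pi * y"
      by (simp_all add: algebra_simps)
    then show ?thesis by (simp only: sin_add sin_diff) simp
  qed
  with Suc show ?case by (simp add: algebra_simps)
qed simp

text \<open>A quantitative O(1/N) rate away from the integers, with \<open>s\<close> measuring the
  distance from them. The estimate starts at 1/2, where the partial sums and their limit both
  vanish.\<close>

lemma sawtooth_partial_sum_bound:
  fixes y s :: real
  assumes s: "0 < s" "\<And>t. t \<in> closed_segment (1/2) y \<Longrightarrow> s \<le> sin (pi * t)"
    and y: "y \<in> {0..1}"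
  shows "\<bar>(\<Sum>h<N. sin (2 * pi * real (Suc h) * y) / real (Suc h)) - pi * (1 / 2 - y)\<bar>
    \<le> (pi / s\<^sup>2 + 1 / s) / (2 * real N + 1)"
proof -
  define M where "M = 2 * real N + 1"
  have M: "M > 0" by (simp add: M_def add_pos_nonneg)
  define T where "T t = (\<Sum>h<N. sin (2 * pi * real (Suc h) * t) / real (Suc h)) - pi * (1 / 2 - t)" for t
  \<comment> \<open>The correction term cancels the leading part of $T'(t) = \pi\sin(\pi M t)/\sin(\pi t)$, as an
    integration by parts would, and leaves a derivative of size $O(1/M)$.\<close>
  define U where "U t = T t + cos (pi * M * t) / (M * sin (pi * t))" for t
  \<comment> \<open>Both parts of \<open>U\<close> vanish at 1/2, the second because
    \<open>M\<close> is odd, so bounding the derivative of \<open>U\<close> bounds \<open>U\<close>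
    itself.\<close>
  have half: "T (1/2) = 0" "cos (pi * M * (1/2)) = 0"
  proof -
    have "sin (2 * pi * real (Suc h) * (1/2)) = 0" for h
      using sin_npi2[of "Suc h"] by (simp add: mult.commute)
    then show "T (1/2) = 0" by (simp add: T_def)
    show "cos (pi * M * (1/2)) = 0"
      unfolding cos_zero_iff_int2 by (rule exI[of _ "int N"]) (simp add: M_def algebra_simps)
  qed
  have dT: "(T has_real_derivative 2 * pi * (1 / 2 + (\<Sum>h<N. cos (2 * pi * real (Suc h) * t)))) (at t)" for t
    unfolding T_def
    by (auto intro!: derivative_eq_intros sum.cong simp: sum_distrib_left algebra_simps
        simp del: of_nat_Suc)
  have dU: "(U has_real_derivative - pi * cos (pi * M * t) * cos (pi * t) / (M * (sin (pi * t))\<^sup>2)) (at t)"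
    if "t \<in> closed_segment (1/2) y" for t
  proof -
    have sn: "sin (pi * t) \<noteq> 0" using s(1) s(2)[OF that] by auto
    have eq: "2 * pi * (1 / 2 + (\<Sum>h<N. cos (2 * pi * real (Suc h) * t))) = pi * sin (pi * M * t) / sin (pi * t)"
    proof -
      have "1 / 2 + (\<Sum>h<N. cos (2 * pi * real (Suc h) * t)) = sin (pi * M * t) / (2 * sin (pi * t))"
        using dirichlet_kernel[of t N, folded M_def] sn by (simp only: nonzero_eq_divide_eq mult_ac)
      then show ?thesis by simp
    qed
    have "((\<lambda>t. cos (pi * M * t) / (M * sin (pi * t))) has_real_derivative
        (- sin (pi * M * t) * (pi * M) * (M * sin (pi * t)) - cos (pi * M * t) * (M * (cos (pi * t) * pi)))
          / ((M * sin (pi * t)) * (M * sin (pi * t)))) (at t)"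
      using sn M by (auto intro!: derivative_eq_intros)
    from DERIV_add[OF dT[of t] this] have "(U has_real_derivative pi * sin (pi * M * t) / sin (pi * t) +
        (- sin (pi * M * t) * (pi * M) * (M * sin (pi * t)) - cos (pi * M * t) * (M * (cos (pi * t) * pi)))
          / ((M * sin (pi * t)) * (M * sin (pi * t)))) (at t)"
      unfolding U_def eq .
    also have "pi * sin (pi * M * t) / sin (pi * t) +
        (- sin (pi * M * t) * (pi * M) * (M * sin (pi * t)) - cos (pi * M * t) * (M * (cos (pi * t) * pi)))
          / ((M * sin (pi * t)) * (M * sin (pi * t))) =
        - pi * cos (pi * M * t) * cos (pi * t) / (M * (sin (pi * t))\<^sup>2)"
      using sn M by (simp add: divide_simps power2_eq_square)
    finally show ?thesis .
  qed
  have bU: "norm (- pi * cos (pi * M * t) * cos (pi * t) / (M * (sin (pi * t))\<^sup>2)) \<le> pi / (M * s\<^sup>2)"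
    if "t \<in> closed_segment (1/2) y" for t
  proof -
    have 1: "\<bar>cos (pi * M * t)\<bar> * \<bar>cos (pi * t)\<bar> \<le> 1 * 1"
      by (intro mult_mono) auto
    have 2: "s\<^sup>2 \<le> (sin (pi * t))\<^sup>2" using s(1) s(2)[OF that] by (intro power_mono) auto
    have "norm (- pi * cos (pi * M * t) * cos (pi * t) / (M * (sin (pi * t))\<^sup>2))
      = pi * (\<bar>cos (pi * M * t)\<bar> * \<bar>cos (pi * t)\<bar>) / (M * (sin (pi * t))\<^sup>2)"
      using M by (simp add: abs_mult)
    also have "\<dots> \<le> pi * (1 * 1) / (M * s\<^sup>2)"
      by (intro frac_le mult_left_mono 1 2) (use M s(1) in auto)
    finally show ?thesis by simp
  qed
  have "norm (U y - U (1/2)) \<le> pi / (M * s\<^sup>2) * norm (y - 1/2)"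
    by (rule field_differentiable_bound[of "closed_segment (1/2) y"])
      (use bU has_field_derivative_at_within[OF dU] in blast)+
  also have "\<dots> \<le> pi / (M * s\<^sup>2) * 1"
    using y M s(1) by (intro mult_left_mono) (auto simp: abs_le_iff)
  finally have 1: "\<bar>U y\<bar> \<le> pi / (M * s\<^sup>2)" using half by (simp add: U_def)
  have "\<bar>cos (pi * M * y) / (M * sin (pi * y))\<bar> \<le> 1 / (M * s)"
  proof -
    have "\<bar>cos (pi * M * y)\<bar> / (M * \<bar>sin (pi * y)\<bar>) \<le> 1 / (M * s)"
      by (intro frac_le mult_left_mono) (use s(1) s(2)[of y] M in auto)
    then show ?thesis using M by (simp add: abs_mult)
  qed
  with 1 have "\<bar>T y\<bar> \<le> pi / (M * s\<^sup>2) + 1 / (M * s)" unfolding U_def by linarith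
  also have "\<dots> = (pi / s\<^sup>2 + 1 / s) / M" using M s(1) by (simp add: field_simps)
  finally show ?thesis by (simp add: T_def M_def)
qed

lemma summable_inverse_squares_Suc: "summable (\<lambda>h. 1 / (real (Suc h))\<^sup>2)"
  using inverse_squares_sums by (auto simp: sums_iff add.commute)

lemma continuous_on_cos_series:
  "continuous_on UNIV (\<lambda>y::real. \<Sum>h. cos (2 * pi * real (Suc h) * y) / (real (Suc h))\<^sup>2)"
proof (rule uniform_limit_theorem)
  show "uniform_limit UNIV (\<lambda>N y. \<Sum>h<N. cos (2 * pi * real (Suc h) * y) / (real (Suc h))\<^sup>2)
     (\<lambda>y. \<Sum>h. cos (2 * pi * real (Suc h) * y) / (real (Suc h))\<^sup>2) sequentially"
    by (rule Weierstrass_m_test[OF _ summable_inverse_squares_Suc])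
      (auto simp: divide_right_mono)
qed (auto intro!: always_eventually continuous_intros)

text \<open>Differentiating a partial sum minus the parabola gives -2 pi times the error of the
  sawtooth partial sum, which is O(1/N) uniformly on \<open>{x..y}\<close>. The increment from
  \<open>x\<close> to \<open>y\<close> therefore vanishes in the limit, and the series never has to
  be differentiated itself.\<close>

lemma cos_series_sums_interior:
  fixes x y :: real
  assumes "0 < x" "x \<le> y" "y < 1"
  defines "G \<equiv> \<lambda>y. (\<Sum>h. cos (2 * pi * real (Suc h) * y) / (real (Suc h))\<^sup>2) - pi\<^sup>2 * (y\<^sup>2 - y)"
  shows "G x = G y"
proof -
  \<comment> \<open>The interval from \<open>e\<close> to \<open>1 - e\<close> contains
    \<open>{x..y}\<close> and 1/2, hence every segment joining 1/2 to a point of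
    \<open>{x..y}\<close>.\<close>
  define e where "e = min x (1 - y) / 2"
  have e: "0 < e" "e < 1/2" "e \<le> x" "y \<le> 1 - e" using assms(1-3) by (auto simp: e_def min_def field_simps)
  define s where "s = sin (pi * e)"
  have s0: "s > 0" unfolding s_def using e by (intro sin_gt_zero) auto
  have sb: "s \<le> sin (pi * t)" if "e \<le> t" "t \<le> 1 - e" for t
  proof (cases "t \<le> 1/2")
    case True then show ?thesis unfolding s_def using that e
      by (intro sin_monotone_2pi_le) (auto simp: mult_left_mono intro: order_trans[of _ 0])
  next
    case False
    have "s \<le> sin (pi * (1 - t))" unfolding s_def using that e False
      by (intro sin_monotone_2pi_le) (auto simp: mult_left_mono intro: order_trans[of _ 0])
    also have "\<dots> = sin (pi * t)" by (simp add: algebra_simps)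
    finally show ?thesis .
  qed
  define W where "W N t = (\<Sum>h<N. cos (2 * pi * real (Suc h) * t) / (real (Suc h))\<^sup>2) - pi\<^sup>2 * (t\<^sup>2 - t)" for N t
  define C where "C = 2 * pi * (pi / s\<^sup>2 + 1 / s)"
  have bound: "\<bar>W N x - W N y\<bar> \<le> C / (2 * real N + 1)" for N
  proof -
    have dW: "(W N has_real_derivative - 2 * pi * ((\<Sum>h<N. sin (2 * pi * real (Suc h) * t) / real (Suc h)) - pi * (1 / 2 - t))) (at t)" for t
      unfolding W_def
      by (auto intro!: derivative_eq_intros sum.cong simp: sum_distrib_left algebra_simps power2_eq_square sum_negf
        simp del: of_nat_Suc)
    have "norm (W N x - W N y) \<le> C / (2 * real N + 1) * norm (x - y)"
    proof (rule field_differentiable_bound[of "{x..y}"])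
      fix t assume t: "t \<in> {x..y}"
      have "\<bar>(\<Sum>h<N. sin (2 * pi * real (Suc h) * t) / real (Suc h)) - pi * (1 / 2 - t)\<bar>
          \<le> (pi / s\<^sup>2 + 1 / s) / (2 * real N + 1)"
        using t e assms by (intro sawtooth_partial_sum_bound s0 sb) (auto simp: closed_segment_eq_real_ivl split: if_splits)
      from mult_left_mono[OF this, of "2 * pi"]
      show "norm (- 2 * pi * ((\<Sum>h<N. sin (2 * pi * real (Suc h) * t) / real (Suc h)) - pi * (1 / 2 - t)))
         \<le> C / (2 * real N + 1)"
        unfolding real_norm_def abs_mult C_def by simp
    next
      show "(W N has_real_derivative - 2 * pi * ((\<Sum>h<N. sin (2 * pi * real (Suc h) * t) / real (Suc h)) - pi * (1 / 2 - t))) (at t within {x..y})" for t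
        by (rule has_field_derivative_at_within[OF dW])
      show "convex {x..y}" "x \<in> {x..y}" "y \<in> {x..y}" using assms(2) by simp_all
    qed
    also have "\<dots> \<le> C / (2 * real N + 1) * 1"
      using assms(1-3) s0 by (intro mult_left_mono) (auto simp: C_def)
    finally show ?thesis by simp
  qed
  have lim: "(\<lambda>N. W N t) \<longlonglongrightarrow> G t" for t
  proof -
    have "summable (\<lambda>h. cos (2 * pi * real (Suc h) * t) / (real (Suc h))\<^sup>2)"
      by (rule summable_comparison_test'[OF summable_inverse_squares_Suc, of 0])
        (auto simp: divide_right_mono)
    then show ?thesis unfolding W_def G_def
      by (intro tendsto_diff tendsto_const summable_LIMSEQ)
  qed
  have "(\<lambda>N. \<bar>W N x - W N y\<bar>) \<longlonglongrightarrow> \<bar>G x - G y\<bar>"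
    by (rule tendsto_rabs[OF tendsto_diff[OF lim lim]])
  moreover have "(\<lambda>N. C / (2 * real N + 1)) \<longlonglongrightarrow> 0" by real_asymp
  ultimately have "\<bar>G x - G y\<bar> \<le> 0"
    by (rule LIMSEQ_le) (use bound in auto)
  then show ?thesis by simp
qed

text \<open>The difference from the parabola is constant inside the interval and, by continuity, up
  to the endpoints; at 0 the Basel sum gives the constant.\<close>

lemma cos_series_eq_bernoulli:
  fixes y :: real
  assumes "0 \<le> y" "y \<le> 1"
  shows "(\<Sum>h. cos (2 * pi * real (Suc h) * y) / (real (Suc h))\<^sup>2) = pi\<^sup>2 * (y\<^sup>2 - y + 1 / 6)"
proof -
  define G where "G = (\<lambda>y. (\<Sum>h. cos (2 * pi * real (Suc h) * y) / (real (Suc h))\<^sup>2) - pi\<^sup>2 * (y\<^sup>2 - y))"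
  have "continuous_on UNIV G" unfolding G_def
    by (intro continuous_intros continuous_on_cos_series[unfolded])
  then have cont: "continuous_on (closure {0<..<1}) G" by (rule continuous_on_subset) simp
  have const: "G t = G (1/2)" if "t \<in> {0<..<1}" for t
    using that cos_series_sums_interior[of t "1/2"] cos_series_sums_interior[of "1/2" t]
    by (cases "t \<le> 1/2") (auto simp: G_def)
  have cl: "G t = G (1/2)" if "t \<in> {0..1}" for t
    using continuous_constant_on_closure[OF cont const, of t] that by simp
  have "G 0 = pi\<^sup>2 / 6"
    using inverse_squares_sums by (simp add: G_def sums_iff add.commute)
  moreover have "G y = G 0" using cl[of y] cl[of 0] assms by simp
  ultimately show ?thesis by (simp add: G_def algebra_simps)
qed

section \<open>Exponential sums\<close>

text \<open>Jordan's inequality: the concave sine lies above its chord on [0, pi/2].\<close>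

lemma sin_pi_ge:
  assumes "0 \<le> t" "t \<le> 1 / 2"
  shows "2 * t \<le> sin (pi * t)"
proof -
  have "concave_on {0..pi/2} sin"
    unfolding concave_on_def
    by (rule f''_ge0_imp_convex[where f'="\<lambda>x. - cos x" and f''=sin])
      (auto intro!: derivative_eq_intros sin_ge_zero)
  from concave_onD[OF this, of "2 * t" 0 "pi/2"] assms show ?thesis
    by (simp add: mult.commute)
qed

definition ue :: "real \<Rightarrow> complex" where "ue t = cis (2 * pi * t)"

lemma norm_ue [simp]: "norm (ue t) = 1" by (simp add: ue_def)

lemma ue_add: "ue (s + t) = ue s * ue t" by (simp add: ue_def cis_mult algebra_simps)

lemma ue_of_int [simp]: "ue (of_int n) = 1"
  by (simp add: ue_def complex_eq_iff cos_int_2pin sin_int_2pin)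

lemma ue_diff_of_int: "ue (t - of_int n) = ue t"
  using ue_add[of "t - of_int n" "of_int n"] by simp

lemma norm_ue_minus_1_le: "norm (ue t - 1) \<le> 2 * pi * \<bar>t\<bar>"
  using dist_exp_i_1[of "2 * pi * t"] abs_sin_x_le_abs_x[of "pi * t"]
  by (simp add: ue_def cis_conv_exp dist_norm abs_mult)

text \<open>Summation by parts: every term is a multiple of the difference between itself and the
  next one, so only boundary terms and the variation of the multipliers remain. Jordan's inequality
  bounds each cotangent by 1/(2 \<delta>), and the total is 1 + 1/\<delta>.\<close>

lemma kusmin_landau:
  fixes a :: "nat \<Rightarrow> real" and \<nu> :: int
  assumes \<delta>: "0 < \<delta>" "\<delta> \<le> 1 / 2"
    and mono: "\<And>n. M \<le> n \<Longrightarrow> Suc n < N \<Longrightarrow> a (Suc n) - a n \<le> a (Suc (Suc n)) - a (Suc n)"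
    and low: "\<And>n. M \<le> n \<Longrightarrow> n < N \<Longrightarrow> of_int \<nu> + \<delta> \<le> a (Suc n) - a n"
    and up: "\<And>n. M \<le> n \<Longrightarrow> n < N \<Longrightarrow> a (Suc n) - a n \<le> of_int \<nu> + 1 - \<delta>"
  shows "norm (\<Sum>n=M..<N. ue (a n)) \<le> 2 / \<delta>"
proof (cases "M < N")
  case False
  then show ?thesis using \<delta> by simp
next
  case True
  define d where "d n = a (Suc n) - a n - of_int \<nu>" for n
  define z where "z n = cot (pi * d n) / 2" for n
  have d: "\<delta> \<le> d n" "d n \<le> 1 - \<delta>" if "M \<le> n" "n < N" for n
    using low[OF that] up[OF that] by (auto simp: d_def)
  have sn: "2 * \<delta> \<le> sin (pi * d n)" if "M \<le> n" "n < N" for n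
  proof (cases "d n \<le> 1/2")
    case True then show ?thesis using sin_pi_ge[of "d n"] d[OF that] \<delta> by auto
  next
    case False
    have "sin (pi * (1 - d n)) = sin (pi * d n)" by (simp add: algebra_simps)
    with False show ?thesis using sin_pi_ge[of "1 - d n"] d[OF that] \<delta> by auto
  qed
  have zb: "\<bar>z n\<bar> \<le> 1 / (4 * \<delta>)" if "M \<le> n" "n < N" for n
  proof -
    have "\<bar>z n\<bar> \<le> 1 / (2 * (2 * \<delta>))" using sn[OF that] \<delta>
      by (auto simp: z_def cot_def abs_mult intro!: frac_le)
    then show ?thesis by simp
  qed
  have zmono: "z (Suc n) \<le> z n" if "M \<le> n" "Suc n < N" for n
  proof -
    have s: "sin (pi * d n) > 0" "sin (pi * d (Suc n)) > 0"
      using sn[of n] sn[of "Suc n"] that \<delta> by auto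
    have "0 \<le> sin (pi * d (Suc n) - pi * d n)"
      using mono[OF that] d[of n] d[of "Suc n"] that \<delta>
      by (intro sin_ge_zero) (auto simp: d_def simp flip: right_diff_distrib)
    then show ?thesis using s by (simp add: z_def cot_def sin_diff field_simps)
  qed
  \<comment> \<open>$c_n = 1/(1 - e^{2\pi i d_n})$; its real part is constant and its imaginary part monotone,
    so its total variation is controlled by its endpoints.\<close>
  define c where "c n = Complex (1/2) (z n)" for n
  have key: "ue (a n) = c n * (ue (a n) - ue (a (Suc n)))" if "M \<le> n" "n < N" for n
  proof -
    have s: "sin (pi * d n) \<noteq> 0" using sn[of n] that \<delta> by auto
    have "ue (a (Suc n)) = ue (a n) * ue (d n)"
      unfolding d_def by (subst ue_diff_of_int) (simp flip: ue_add)
    moreover have "c n * (1 - ue (d n)) = 1"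
    proof -
      have "ue (d n) = cis (pi * d n) * cis (pi * d n)" by (simp add: ue_def cis_mult algebra_simps)
      moreover have "c n = Complex (sin (pi * d n)) (cos (pi * d n)) / (2 * of_real (sin (pi * d n)))"
        using s by (auto simp: c_def z_def cot_def complex_eq_iff)
      ultimately show ?thesis using s
        apply (simp add: complex_eq_iff divide_simps)
        using sin_cos_squared_add[of "pi * d n"]
        by (simp add: power2_eq_square) algebra
    qed
    ultimately have "c n * (ue (a n) - ue (a (Suc n))) = ue (a n) * (c n * (1 - ue (d n)))"
      by (simp add: algebra_simps)
    with \<open>c n * (1 - ue (d n)) = 1\<close> show ?thesis by simp
  qed
  have parts: "(\<Sum>n=M..<N. c n * (ue (a n) - ue (a (Suc n))))
      = c M * ue (a M) - c (N - 1) * ue (a N) + (\<Sum>n=M..<N-1. (c (Suc n) - c n) * ue (a (Suc n)))"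
    if "M < N" for N using that
  proof (induction N)
    case (Suc N)
    show ?case
    proof (cases "M < N")
      case True
      then obtain K where K: "N = Suc K" "M \<le> K" by (cases N) auto
      show ?thesis using Suc.IH[OF True] K by (simp add: algebra_simps)
    next
      case False
      with Suc have "N = M" by simp
      then show ?thesis by (simp add: algebra_simps)
    qed
  qed simp
  have cb: "norm (c n) \<le> 1/2 + \<bar>z n\<bar>" for n
    using cmod_le[of "c n"] by (simp add: c_def)
  have cd: "norm (c (Suc n) - c n) = z n - z (Suc n)" if "M \<le> n" "Suc n < N" for n
    using zmono[OF that] by (simp add: c_def cmod_def)
  have "(\<Sum>n=M..<N. ue (a n)) = (\<Sum>n=M..<N. c n * (ue (a n) - ue (a (Suc n))))"
    by (rule sum.cong) (use key in auto)
  also have "\<dots> = c M * ue (a M) - c (N - 1) * ue (a N) + (\<Sum>n=M..<N-1. (c (Suc n) - c n) * ue (a (Suc n)))"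
    by (rule parts[OF True])
  also have "norm \<dots> \<le> norm (c M * ue (a M)) + norm (c (N - 1) * ue (a N)) + (\<Sum>n=M..<N-1. norm (c (Suc n) - c n))"
    by (rule order_trans[OF norm_triangle_ineq])
      (auto simp: norm_mult intro!: add_mono sum_norm_le order_trans[OF norm_triangle_ineq4])
  also have "(\<Sum>n=M..<N-1. norm (c (Suc n) - c n)) = (\<Sum>n=M..<N-1. z n - z (Suc n))"
    by (rule sum.cong) (auto intro!: cd)
  also have "\<dots> = z M - z (N - 1)"
    using sum_Suc_diff'[of M "N-1" "\<lambda>n. - z n"] True by simp
  also have "norm (c M * ue (a M)) + norm (c (N - 1) * ue (a N)) + (z M - z (N - 1)) \<le>
      (1/2 + 1 / (4 * \<delta>)) + (1/2 + 1 / (4 * \<delta>)) + (1 / (4 * \<delta>) + 1 / (4 * \<delta>))"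
  proof -
    have "M \<le> N - 1" "N - 1 < N" using True by auto
    then show ?thesis
      using cb[of M] cb[of "N - 1"] zb[of M] zb[of "N - 1"] True
      unfolding norm_mult norm_ue by linarith
  qed
  also have "\<dots> \<le> 2 / \<delta>" using \<delta> by (simp add: field_simps)
  finally show ?thesis .
qed

section \<open>From the Kusmin-Landau inequality to a second derivative test\<close>

lemma card_gap_le:
  fixes d :: "nat \<Rightarrow> real"
  assumes fin: "finite S" and g: "g > 0" and w: "w \<ge> 0"
    and gap: "\<And>m n. m \<in> S \<Longrightarrow> n \<in> S \<Longrightarrow> m \<le> n \<Longrightarrow> g * (real n - real m) \<le> d n - d m"
    and width: "\<And>n. n \<in> S \<Longrightarrow> x \<le> d n \<and> d n \<le> x + w"
  shows "real (card S) \<le> w / g + 1"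
proof (cases "S = {}")
  case True
  then show ?thesis using g w by simp
next
  case False
  let ?m = "Min S" and ?M = "Max S"
  have mM: "?m \<in> S" "?M \<in> S" "?m \<le> ?M" using fin False by auto
  have "S \<subseteq> {?m..?M}" using fin by auto
  then have "card S \<le> card {?m..?M}" by (intro card_mono) auto
  then have "real (card S) \<le> real ?M - real ?m + 1" using mM(3) by simp
  moreover have "g * (real ?M - real ?m) \<le> w"
    using gap[OF mM] width[OF mM(1)] width[OF mM(2)] by linarith
  then have "real ?M - real ?m \<le> w / g" using g by (simp add: field_simps)
  ultimately show ?thesis by linarith
qed

lemma nat_convex_eq_atLeastLessThan:
  fixes S :: "nat set"
  assumes "finite S" "\<And>m n k. m \<in> S \<Longrightarrow> n \<in> S \<Longrightarrow> m \<le> k \<Longrightarrow> k \<le> n \<Longrightarrow> k \<in> S"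
  obtains M N where "S = {M..<N}"
proof (cases "S = {}")
  case True
  then show ?thesis using that[of 0 0] by simp
next
  case False
  have "Min S \<in> S" "Max S \<in> S" using assms(1) False by auto
  from assms(2)[OF this] have "{Min S..<Suc (Max S)} \<subseteq> S" by auto
  moreover have "S \<subseteq> {Min S..<Suc (Max S)}" using assms(1) by (auto simp: less_Suc_eq_le)
  ultimately have "S = {Min S..<Suc (Max S)}" by (rule subset_antisym[rotated])
  then show ?thesis by (rule that)
qed

text \<open>Indices whose difference is within \<delta> of either end of the cell are few, by
  \<open>card_gap_le\<close>, and are bounded trivially. The others form an interval because the
  differences increase, so Kusmin-Landau applies to them. The choice of \<delta> is left to the
  caller.\<close>

lemma exp_sum_integer_cell:
  fixes a :: "nat \<Rightarrow> real" and \<nu> :: int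
  assumes g: "g > 0" and \<delta>: "\<delta> > 0"
    and gap: "\<And>m n. A \<le> m \<Longrightarrow> m \<le> n \<Longrightarrow> n < B \<Longrightarrow>
      g * (real n - real m) \<le> (a (Suc n) - a n) - (a (Suc m) - a m)"
  shows "norm (\<Sum>n | n \<in> {A..<B} \<and> \<lfloor>a (Suc n) - a n\<rfloor> = \<nu>. ue (a n)) \<le> 2 * (\<delta> / g + 1) + 2 / \<delta>"
proof -
  define d where "d n = a (Suc n) - a n" for n
  define S where "S = {n \<in> {A..<B}. \<lfloor>d n\<rfloor> = \<nu>}"
  define S1 where "S1 = {n \<in> S. d n \<le> of_int \<nu> + \<delta>}"
  define S2 where "S2 = {n \<in> S. d n \<ge> of_int \<nu> + 1 - \<delta>}"
  define S3 where "S3 = {n \<in> S. of_int \<nu> + \<delta> \<le> d n \<and> d n \<le> of_int \<nu> + 1 - \<delta>}"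
  have fin: "finite S" "finite S1" "finite S2" "finite S3" by (auto simp: S_def S1_def S2_def S3_def)
  have S: "of_int \<nu> \<le> d n" "d n \<le> of_int \<nu> + 1" "A \<le> n" "n < B" if "n \<in> S" for n
    using that by (auto simp: S_def floor_eq_iff)
  have gap': "g * (real n - real m) \<le> d n - d m" if "m \<in> S" "n \<in> S" "m \<le> n" for m n
    using gap[of m n] S(3)[OF that(1)] S(4)[OF that(2)] that by (simp add: d_def)
  have c1: "real (card S1) \<le> \<delta> / g + 1"
    by (rule card_gap_le[where x="of_int \<nu>" and d=d])
      (use fin g \<delta> gap' S in \<open>auto simp: S1_def\<close>)
  have c2: "real (card S2) \<le> \<delta> / g + 1"
    by (rule card_gap_le[where x="of_int \<nu> + 1 - \<delta>" and d=d])
      (use fin g \<delta> gap' S in \<open>auto simp: S2_def\<close>)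
  have mono: "d m \<le> d n" if "A \<le> m" "m \<le> n" "n < B" for m n
  proof -
    have "0 \<le> g * (real n - real m)" using g that by simp
    with gap[OF that] show ?thesis by (simp add: d_def)
  qed
  have c3: "norm (\<Sum>n\<in>S3. ue (a n)) \<le> 2 / \<delta>"
  proof (cases "\<delta> \<le> 1/2")
    case False
    \<comment> \<open>The two margins overlap, so any positive \<delta> is admissible although
      \<open>kusmin_landau\<close> asks for at most 1/2.\<close>
    then have "S3 = {}" by (auto simp: S3_def)
    then show ?thesis using \<delta> by simp
  next
    case True
    have "S3 = {n \<in> {A..<B}. of_int \<nu> + \<delta> \<le> d n \<and> d n \<le> of_int \<nu> + 1 - \<delta>}"
      using \<delta> by (auto simp: S3_def S_def floor_eq_iff)
    then have in3: "n \<in> S3 \<longleftrightarrow> A \<le> n \<and> n < B \<and> of_int \<nu> + \<delta> \<le> d n \<and> d n \<le> of_int \<nu> + 1 - \<delta>" for n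
      by auto
    obtain M N where MN: "S3 = {M..<N}"
    proof (rule nat_convex_eq_atLeastLessThan[OF fin(4)])
      fix m n k assume "m \<in> S3" "n \<in> S3" "m \<le> k" "k \<le> n"
      with mono[of m k] mono[of k n] show "k \<in> S3" unfolding in3 by linarith
    qed
    show ?thesis unfolding MN
    proof (rule kusmin_landau[OF \<delta> True, of M N a \<nu>])
      fix n assume "M \<le> n" "Suc n < N"
      then have "n \<in> S3" "Suc n \<in> S3" by (auto simp: MN)
      then show "a (Suc n) - a n \<le> a (Suc (Suc n)) - a (Suc n)"
        using mono[of n "Suc n"] by (auto simp: in3 d_def)
    next
      fix n assume "M \<le> n" "n < N"
      then have "n \<in> S3" by (auto simp: MN)
      then show "of_int \<nu> + \<delta> \<le> a (Suc n) - a n" "a (Suc n) - a n \<le> of_int \<nu> + 1 - \<delta>"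
        by (auto simp: in3 d_def)
    qed
  qed
  have "norm (\<Sum>n\<in>S. ue (a n)) \<le> norm (\<Sum>n\<in>S3. ue (a n)) + norm (\<Sum>n\<in>S - S3. ue (a n))"
    using sum.subset_diff[of S3 S "\<lambda>n. ue (a n)"] fin norm_triangle_ineq
    by (auto simp: S3_def add.commute)
  also have "norm (\<Sum>n\<in>S - S3. ue (a n)) \<le> real (card (S - S3))"
    by (rule order_trans[OF norm_sum]) simp
  also have "card (S - S3) \<le> card (S1 \<union> S2)"
    by (rule card_mono) (use fin in \<open>auto simp: S1_def S2_def S3_def\<close>)
  also have "\<dots> \<le> card S1 + card S2" by (rule card_Un_le)
  finally show ?thesis using c1 c2 c3 unfolding S_def d_def by simp
qed

text \<open>The differences of \<open>real h * x n\<close> lie in [0, h] and grow at rate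
  \<open>real h * \<mu>\<close>, so there are at most h + 1 cells. With \<delta> = sqrt(h \<mu>)
  both the margins and the middle of a cell cost O(1/\<delta>), in total O(h/\<delta>) =
  O(sqrt(h/\<mu>)). If h \<mu> is at least 1 the trivial bound 1/\<mu> is already small
  enough.\<close>

lemma exp_sum_second_derivative_test:
  fixes x :: "nat \<Rightarrow> real" and h :: nat
  assumes \<mu>: "\<mu> > 0" and h: "h \<ge> 1" and AB: "real (B - A) \<le> 1 / \<mu>"
    and d0: "\<And>n. A \<le> n \<Longrightarrow> Suc n < B \<Longrightarrow> 0 \<le> x (Suc n) - x n \<and> x (Suc n) - x n \<le> 1"
    and gap: "\<And>m n. A \<le> m \<Longrightarrow> m \<le> n \<Longrightarrow> Suc n < B \<Longrightarrow>
      \<mu> * (real n - real m) \<le> (x (Suc n) - x n) - (x (Suc m) - x m)"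
  shows "norm (\<Sum>n=A..<B. ue (real h * x n)) \<le> 13 * sqrt (real h / \<mu>)"
proof (cases "real h * \<mu> \<ge> 1")
  case True
  have "norm (\<Sum>n=A..<B. ue (real h * x n)) \<le> real (B - A)"
    by (rule order_trans[OF norm_sum]) simp
  also have "\<dots> \<le> 1 / \<mu>" by (rule AB)
  also have "\<dots> \<le> sqrt (real h / \<mu>)"
  proof (rule real_le_rsqrt)
    have "(1 / \<mu>)\<^sup>2 * 1 \<le> (1 / \<mu>)\<^sup>2 * (real h * \<mu>)" using True by (intro mult_left_mono) auto
    also have "\<dots> = real h / \<mu>" using \<mu> by (simp add: field_simps power2_eq_square)
    finally show "(1 / \<mu>)\<^sup>2 \<le> real h / \<mu>" by simp
  qed
  also have "\<dots> \<le> 13 * sqrt (real h / \<mu>)" using \<mu> by simp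
  finally show ?thesis .
next
  case False
  \<comment> \<open>Balances the trivial bound near integer differences against Kusmin--Landau elsewhere.\<close>
  define \<delta> where "\<delta> = sqrt (real h * \<mu>)"
  have \<delta>: "0 < \<delta>" "\<delta> \<le> 1" "\<delta> * \<delta> = real h * \<mu>" using False \<mu> h by (auto simp: \<delta>_def)
  have \<delta>h: "real h / \<delta> = sqrt (real h / \<mu>)"
    using \<mu> h by (simp add: \<delta>_def real_sqrt_divide real_sqrt_mult field_simps)
  define a where "a n = real h * x n" for n
  have a: "a (Suc n) - a n = real h * (x (Suc n) - x n)" for n by (simp add: a_def algebra_simps)
  have gapa: "real h * \<mu> * (real n - real m) \<le> (a (Suc n) - a n) - (a (Suc m) - a m)"
    if "A \<le> m" "m \<le> n" "n < B - 1" for m n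
    using mult_left_mono[OF gap[of m n], of "real h"] that unfolding a
    by (simp add: algebra_simps)
  have fl: "\<lfloor>a (Suc n) - a n\<rfloor> \<in> {0..int h}" if "n \<in> {A..<B-1}" for n
  proof -
    have "0 \<le> x (Suc n) - x n \<and> x (Suc n) - x n \<le> 1" using d0[of n] that by auto
    then have "0 \<le> a (Suc n) - a n" "a (Suc n) - a n \<le> real h"
      unfolding a by (auto intro: mult_left_le)
    then show ?thesis by (auto simp: le_floor_iff floor_le_iff)
  qed
  have "(\<Sum>n=A..<B-1. ue (a n)) = (\<Sum>\<nu>\<in>{0..int h}. \<Sum>n | n \<in> {A..<B-1} \<and> \<lfloor>a (Suc n) - a n\<rfloor> = \<nu>. ue (a n))"
    by (rule sum.group[symmetric]) (use fl in auto)
  also have "norm \<dots> \<le> (\<Sum>\<nu>\<in>{0..int h}. 2 * (\<delta> / (real h * \<mu>) + 1) + 2 / \<delta>)"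
    by (rule sum_norm_le, rule exp_sum_integer_cell) (use \<delta> \<mu> h gapa in auto)
  also have "\<dots> = (real h + 1) * (2 * (1 / \<delta> + 1) + 2 / \<delta>)"
    using \<delta>(1) unfolding \<delta>(3)[symmetric] by simp
  also have "\<dots> \<le> (2 * real h) * (6 / \<delta>)"
    by (intro mult_mono) (use \<delta> h in \<open>auto simp: field_simps\<close>)
  finally have 1: "norm (\<Sum>n=A..<B-1. ue (a n)) \<le> 12 * (real h / \<delta>)" by simp
  \<comment> \<open>The difference at the last index involves \<open>x B\<close>, about which
    nothing is assumed, so that term is split off. It is paid for by h/\<delta>, raising 12 to
    13.\<close>
  have "norm (\<Sum>n=A..<B. ue (a n)) \<le> norm (\<Sum>n=A..<B-1. ue (a n)) + 1"
  proof (cases "A < B")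
    case True
    then obtain K where "B = Suc K" "A \<le> K" by (cases B) auto
    then show ?thesis using norm_triangle_ineq[of "\<Sum>n=A..<K. ue (a n)" "ue (a K)"] by simp
  qed simp
  also have "1 \<le> real h / \<delta>" using \<delta> h by (simp add: field_simps)
  finally show ?thesis using 1 unfolding \<delta>h[symmetric] a_def by linarith
qed

section \<open>Sums of the sawtooth function\<close>

text \<open>With m the floor of v, the right side minus the left is m (2v - m - 1), and for an
  integer m the two factors never have opposite signs.\<close>

lemma frac_quadratic_le: "(frac v)\<^sup>2 - frac v \<le> v\<^sup>2 - (v::real)"
proof -
  define m where "m = \<lfloor>v\<rfloor>"
  have m: "of_int m \<le> v" "v < of_int m + 1" by (auto simp: m_def)
  have "0 \<le> of_int m * (2 * v - of_int m - 1)"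
  proof (cases "m \<ge> 1")
    case True
    then have "real_of_int m \<ge> 1" by simp
    with m show ?thesis by (intro mult_nonneg_nonneg) linarith+
  next
    case False
    show ?thesis
    proof (cases "m = 0")
      case False
      with \<open>\<not> m \<ge> 1\<close> have "real_of_int m \<le> -1" by linarith
      with m show ?thesis by (intro mult_nonpos_nonpos) linarith+
    qed simp
  qed
  moreover have fr: "frac v = v - of_int m" by (simp add: frac_def m_def)
  ultimately show ?thesis unfolding fr by (simp add: power2_eq_square algebra_simps)
qed

text \<open>For the parabola t^2 - t taken at \<open>frac y\<close> and \<open>frac y\<close>
  shifted by \<eta>, both relations would be equalities. Replacing its shifted value by that of the
  periodic extension lowers it, by \<open>frac_quadratic_le\<close>, which helps in both
  directions.\<close>

lemma sawtooth_le_difference_quotient: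
  fixes y \<eta> :: real
  assumes "\<eta> > 0"
  shows "frac y - 1 / 2 \<le> (((frac y)\<^sup>2 - frac y) - ((frac (y - \<eta>))\<^sup>2 - frac (y - \<eta>))) / (2 * \<eta>) + \<eta> / 2"
    and "(((frac (y + \<eta>))\<^sup>2 - frac (y + \<eta>)) - ((frac y)\<^sup>2 - frac y)) / (2 * \<eta>) - \<eta> / 2 \<le> frac y - 1 / 2"
proof -
  have frac_shift: "frac (y + t) = frac (frac y + t)" for t
    using frac_add[of "frac y + t" "of_int \<lfloor>y\<rfloor>"] by (simp add: frac_def algebra_simps)
  have "(frac (y - \<eta>))\<^sup>2 - frac (y - \<eta>) \<le> (frac y - \<eta>)\<^sup>2 - (frac y - \<eta>)"
    using frac_quadratic_le[of "frac y - \<eta>"] frac_shift[of "- \<eta>", symmetric] by simp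
  with assms show "frac y - 1 / 2 \<le> (((frac y)\<^sup>2 - frac y) - ((frac (y - \<eta>))\<^sup>2 - frac (y - \<eta>))) / (2 * \<eta>) + \<eta> / 2"
    by (simp add: field_simps power2_eq_square)
  have "(frac (y + \<eta>))\<^sup>2 - frac (y + \<eta>) \<le> (frac y + \<eta>)\<^sup>2 - (frac y + \<eta>)"
    using frac_quadratic_le[of "frac y + \<eta>"] unfolding frac_shift[of \<eta>, symmetric] .
  with assms show "(((frac (y + \<eta>))\<^sup>2 - frac (y + \<eta>)) - ((frac y)\<^sup>2 - frac y)) / (2 * \<eta>) - \<eta> / 2 \<le> frac y - 1 / 2"
    by (simp add: field_simps power2_eq_square)
qed

lemma cos_series_sums_frac:
  "(\<lambda>h. cos (2 * pi * real (Suc h) * y) / (real (Suc h))\<^sup>2) sums (pi\<^sup>2 * ((frac y)\<^sup>2 - frac y + 1 / 6))"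
proof -
  have per: "cos (2 * pi * real (Suc h) * y) = cos (2 * pi * real (Suc h) * frac y)" for h
  proof -
    have "2 * pi * real (Suc h) * y = 2 * pi * real (Suc h) * frac y + 2 * pi * of_int (int (Suc h) * \<lfloor>y\<rfloor>)"
      by (simp add: frac_def algebra_simps)
    then show ?thesis by (simp only: cos_add sin_int_2pin cos_int_2pin)
  qed
  have "summable (\<lambda>h. cos (2 * pi * real (Suc h) * y) / (real (Suc h))\<^sup>2)"
    by (rule summable_comparison_test'[OF summable_inverse_squares_Suc, of 0])
      (auto simp: divide_right_mono)
  from summable_sums[OF this] show ?thesis
    using cos_series_eq_bernoulli[of "frac y"] by (simp only: per frac_ge_0 frac_lt_1 less_imp_le)
qed

text \<open>In the summand, \<open>sqrt\<close> is the growth of the exponential sums, the square in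
  the denominator comes from the Fourier coefficients, and the minimum is the effect of a shift by
  1/H on frequency h.\<close>

lemma truncated_three_halves_sum_le:
  fixes H N :: nat
  assumes H: "H \<ge> 1"
  shows "(\<Sum>h<N. sqrt (real (Suc h)) / (real (Suc h))\<^sup>2 * min 1 (real (Suc h) / real H)) \<le> 4 / sqrt (real H)"
proof -
  \<comment> \<open>A telescoping majorant: up to \<open>H\<close> an antiderivative of h^(-1/2)/H,
    beyond it one of h^(-3/2). The constant 4 makes the two pieces agree at
    \<open>H\<close>.\<close>
  define F where "F n = (if n \<le> H then 2 * sqrt (real n) / real H else 4 / sqrt (real H) - 2 / sqrt (real n))" for n
  have FH: "F n = 4 / sqrt (real H) - 2 / sqrt (real n)" if "n \<ge> H" for n
    using that H by (auto simp: F_def field_simps)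
  have step: "sqrt (real (Suc h)) / (real (Suc h))\<^sup>2 * min 1 (real (Suc h) / real H) \<le> F (Suc h) - F h" for h
  proof -
    define u v where "u = sqrt (real h)" and "v = sqrt (real (Suc h))"
    have uv: "0 \<le> u" "u \<le> v" "0 < v" "v * v = u * u + 1" "real (Suc h) = v * v" "real h = u * u"
      by (auto simp: u_def v_def)
    have sv: "sqrt (v * v) = v" using uv by simp
    have "(v - u) * (v + u) = 1" using uv by (simp add: algebra_simps)
    then have dv: "1 / (2 * v) \<le> v - u"
      using uv mult_left_mono[of "v + u" "2 * v" "v - u"] by (simp add: field_simps)
    show ?thesis
    proof (cases "Suc h \<le> H")
      case True
      have "sqrt (real (Suc h)) / (real (Suc h))\<^sup>2 * min 1 (real (Suc h) / real H) \<le> v / (v * v)\<^sup>2 * (v * v / real H)"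
        unfolding uv(5) sv using uv by (intro mult_left_mono) auto
      also have "\<dots> = 1 / v / real H" using uv by (simp add: power2_eq_square field_simps)
      also have "\<dots> \<le> 2 * (v - u) / real H" using dv by (intro divide_right_mono) auto
      also have "\<dots> = F (Suc h) - F h" using True H by (simp add: F_def u_def v_def field_simps)
      finally show ?thesis .
    next
      case False
      then have u: "u > 0" using H by (auto simp: u_def)
      have "sqrt (real (Suc h)) / (real (Suc h))\<^sup>2 * min 1 (real (Suc h) / real H) \<le> v / (v * v)\<^sup>2 * 1"
        unfolding uv(5) sv using uv by (intro mult_left_mono) auto
      also have "\<dots> = 1 / v / (v * v)" using uv by (simp add: power2_eq_square field_simps)
      also have "\<dots> \<le> 2 * (v - u) / (u * v)"
        using dv uv u by (intro frac_le mult_mono) auto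
      also have "\<dots> = 2 / u - 2 / v" using u uv by (simp add: field_simps)
      also have "\<dots> = F (Suc h) - F h" using False FH[of h] FH[of "Suc h"] by (simp add: u_def v_def)
      finally show ?thesis .
    qed
  qed
  have "(\<Sum>h<N. sqrt (real (Suc h)) / (real (Suc h))\<^sup>2 * min 1 (real (Suc h) / real H))
      \<le> (\<Sum>h<N. F (Suc h) - F h)" by (rule sum_mono) (rule step)
  also have "\<dots> = F N" by (subst sum_lessThan_telescope) (simp add: F_def)
  also have "\<dots> \<le> 4 / sqrt (real H)"
  proof (cases "N \<le> H")
    case True
    then have "F N \<le> 2 * sqrt (real H) / real H" by (auto simp: F_def intro!: divide_right_mono)
    also have "\<dots> = 2 / sqrt (real H)" using H by (simp add: field_simps)
    also have "\<dots> \<le> 4 / sqrt (real H)" by (intro divide_right_mono) auto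
    finally show ?thesis .
  qed (use FH[of N] in auto)
  finally show ?thesis .
qed

text \<open>A common shift multiplies every \<open>ue (h * x n)\<close> by the same factor
  \<open>ue (h * t)\<close>, so \<open>ue (h * t) - 1\<close> factors out. Its norm is at most 2 and
  at most 2 pi times the absolute value of \<open>h * t\<close>.\<close>

lemma shifted_cos_sum_le:
  fixes x :: "'a \<Rightarrow> real"
  shows "\<bar>\<Sum>n\<in>S. cos (2 * pi * h * (x n + t)) - cos (2 * pi * h * x n)\<bar>
    \<le> 2 * pi * min 1 \<bar>h * t\<bar> * norm (\<Sum>n\<in>S. ue (h * x n))"
proof -
  have "(\<Sum>n\<in>S. cos (2 * pi * h * (x n + t)) - cos (2 * pi * h * x n)) = Re ((ue (h * t) - 1) * (\<Sum>n\<in>S. ue (h * x n)))"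
  proof -
    have "ue (h * (x n + t)) = ue (h * t) * ue (h * x n)" for n
      by (simp add: algebra_simps flip: ue_add)
    then have "(ue (h * t) - 1) * (\<Sum>n\<in>S. ue (h * x n)) = (\<Sum>n\<in>S. ue (h * (x n + t)) - ue (h * x n))"
      by (simp add: sum_distrib_left algebra_simps sum_subtractf)
    then show ?thesis by (simp add: ue_def mult.assoc)
  qed
  also have "\<bar>\<dots>\<bar> \<le> norm (ue (h * t) - 1) * norm (\<Sum>n\<in>S. ue (h * x n))"
    unfolding norm_mult[symmetric] by (rule abs_Re_le_cmod)
  also have "\<dots> \<le> 2 * pi * min 1 \<bar>h * t\<bar> * norm (\<Sum>n\<in>S. ue (h * x n))"
  proof (rule mult_right_mono)
    have "norm (ue (h * t) - 1) \<le> 2" using norm_triangle_ineq4[of "ue (h * t)" 1] by simp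
    also have "2 \<le> 2 * pi * 1" using pi_ge_two by simp
    finally show "norm (ue (h * t) - 1) \<le> 2 * pi * min 1 \<bar>h * t\<bar>"
      using norm_ue_minus_1_le[of "h * t"] by (simp add: min_def)
  qed simp
  finally show ?thesis .
qed

text \<open>The shift damps frequencies h < H by h/H, which gains a factor 1/sqrt(H) over the sum of
  h^(-3/2). This gain survives the later division by a step of size 1/H.\<close>

lemma bernoulli_shift_sum_le:
  fixes x :: "'a \<Rightarrow> real" and H :: nat
  assumes "H \<ge> 1" "\<bar>t\<bar> = 1 / real H"
    and K: "\<And>h::nat. h \<ge> 1 \<Longrightarrow> norm (\<Sum>n\<in>S. ue (real h * x n)) \<le> K * sqrt (real h)"
  shows "\<bar>\<Sum>n\<in>S. ((frac (x n + t))\<^sup>2 - frac (x n + t)) - ((frac (x n))\<^sup>2 - frac (x n))\<bar> \<le> 4 * K / sqrt (real H)"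
    (is "\<bar>?D\<bar> \<le> _")
proof -
  define c where "c h = (\<Sum>n\<in>S. cos (2 * pi * real (Suc h) * (x n + t)) - cos (2 * pi * real (Suc h) * x n)) / (real (Suc h))\<^sup>2" for h
  have K0: "K \<ge> 0" using order_trans[OF norm_ge_zero K[of 1]] by simp
  have "(\<lambda>h. \<Sum>n\<in>S. cos (2 * pi * real (Suc h) * (x n + t)) / (real (Suc h))\<^sup>2 - cos (2 * pi * real (Suc h) * x n) / (real (Suc h))\<^sup>2)
      sums (\<Sum>n\<in>S. pi\<^sup>2 * ((frac (x n + t))\<^sup>2 - frac (x n + t) + 1 / 6) - pi\<^sup>2 * ((frac (x n))\<^sup>2 - frac (x n) + 1 / 6))"
    by (intro sums_sum sums_diff cos_series_sums_frac)
  also have "(\<Sum>n\<in>S. pi\<^sup>2 * ((frac (x n + t))\<^sup>2 - frac (x n + t) + 1 / 6) - pi\<^sup>2 * ((frac (x n))\<^sup>2 - frac (x n) + 1 / 6)) = pi\<^sup>2 * ?D"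
    unfolding sum_distrib_left by (intro sum.cong) (auto simp: algebra_simps)
  also have "(\<lambda>h. \<Sum>n\<in>S. cos (2 * pi * real (Suc h) * (x n + t)) / (real (Suc h))\<^sup>2 - cos (2 * pi * real (Suc h) * x n) / (real (Suc h))\<^sup>2) = c"
    by (rule ext) (simp only: c_def sum_divide_distrib diff_divide_distrib)
  finally have lim: "(\<lambda>N. \<bar>\<Sum>h<N. c h\<bar>) \<longlonglongrightarrow> \<bar>pi\<^sup>2 * ?D\<bar>"
    unfolding sums_def by (rule tendsto_rabs)
  have bound: "\<bar>\<Sum>h<N. c h\<bar> \<le> 2 * pi * K * (4 / sqrt (real H))" for N
  proof -
    have ch: "\<bar>c h\<bar> \<le> 2 * pi * K * (sqrt (real (Suc h)) / (real (Suc h))\<^sup>2 * min 1 (real (Suc h) / real H))" for h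
    proof -
      have "\<bar>real (Suc h) * t\<bar> = real (Suc h) / real H" unfolding abs_mult assms(2) by simp
      then have "\<bar>c h\<bar> \<le> 2 * pi * min 1 (real (Suc h) / real H) * norm (\<Sum>n\<in>S. ue (real (Suc h) * x n)) / (real (Suc h))\<^sup>2"
        using shifted_cos_sum_le[of "real (Suc h)" x t S] unfolding c_def abs_divide
        by (simp add: divide_right_mono del: of_nat_Suc)
      also have "\<dots> \<le> 2 * pi * min 1 (real (Suc h) / real H) * (K * sqrt (real (Suc h))) / (real (Suc h))\<^sup>2"
        using K[of "Suc h"] by (intro divide_right_mono mult_left_mono) auto
      finally show ?thesis by (simp add: mult_ac)
    qed
    have "\<bar>\<Sum>h<N. c h\<bar> \<le> (\<Sum>h<N. 2 * pi * K * (sqrt (real (Suc h)) / (real (Suc h))\<^sup>2 * min 1 (real (Suc h) / real H)))"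
      by (rule order_trans[OF sum_abs]) (intro sum_mono ch)
    also have "\<dots> \<le> 2 * pi * K * (4 / sqrt (real H))"
      unfolding sum_distrib_left[symmetric]
      by (rule mult_left_mono[OF truncated_three_halves_sum_le[OF assms(1)]]) (use K0 in simp)
    finally show ?thesis .
  qed
  have "\<bar>pi\<^sup>2 * ?D\<bar> \<le> 2 * pi * K * (4 / sqrt (real H))"
    by (rule LIMSEQ_le_const2[OF lim]) (use bound in auto)
  \<comment> \<open>One factor pi cancels and the other is bounded below by 2, which turns 8 into
    4.\<close>
  then have "pi * (pi * \<bar>?D\<bar>) \<le> pi * (2 * K * (4 / sqrt (real H)))"
    by (simp add: abs_mult power2_eq_square mult_ac)
  then have "pi * \<bar>?D\<bar> \<le> 2 * (4 * K / sqrt (real H))"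
    by (subst (asm) mult_le_cancel_left_pos) (auto simp: mult_ac)
  moreover have "2 * \<bar>?D\<bar> \<le> pi * \<bar>?D\<bar>" by (intro mult_right_mono pi_ge_two) auto
  ultimately show ?thesis by linarith
qed

text \<open>Dividing the bound 4K/sqrt(H) by the double step 2/H gives the first term; the
  correction \<eta>/2 per summand gives the second. The upper estimate shifts by -\<eta>, the lower
  one by \<eta>.\<close>

lemma sawtooth_sum_le:
  fixes x :: "'a \<Rightarrow> real" and H :: nat
  assumes "H \<ge> 1"
    and K: "\<And>h::nat. h \<ge> 1 \<Longrightarrow> norm (\<Sum>n\<in>S. ue (real h * x n)) \<le> K * sqrt (real h)"
  shows "\<bar>\<Sum>n\<in>S. frac (x n) - 1 / 2\<bar> \<le> 2 * K * sqrt (real H) + real (card S) / (2 * real H)"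
proof -
  define P where "P v = (frac v)\<^sup>2 - frac v" for v :: real
  define \<eta> where "\<eta> = 1 / real H"
  have \<eta>: "\<eta> > 0" "2 * \<eta> > 0" using assms by (auto simp: \<eta>_def)
  have D: "\<bar>\<Sum>n\<in>S. P (x n + t) - P (x n)\<bar> / (2 * \<eta>) \<le> 2 * K * sqrt (real H)" if "\<bar>t\<bar> = \<eta>" for t
  proof -
    have "\<bar>\<Sum>n\<in>S. P (x n + t) - P (x n)\<bar> / (2 * \<eta>) \<le> 4 * K / sqrt (real H) / (2 * \<eta>)"
      using bernoulli_shift_sum_le[OF assms(1) _ K, of t] that \<eta>
      by (intro divide_right_mono) (auto simp: P_def \<eta>_def)
    also have "\<dots> = 2 * K * sqrt (real H)" using assms(1) by (simp add: \<eta>_def field_simps)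
    finally show ?thesis .
  qed
  have c: "real (card S) / (2 * real H) = (\<Sum>n\<in>S. \<eta> / 2)" by (simp add: \<eta>_def)
  have "(\<Sum>n\<in>S. frac (x n) - 1 / 2) \<le> (\<Sum>n\<in>S. (P (x n) - P (x n - \<eta>)) / (2 * \<eta>) + \<eta> / 2)"
    unfolding P_def by (intro sum_mono sawtooth_le_difference_quotient \<eta>)
  also have "\<dots> = - (\<Sum>n\<in>S. P (x n + - \<eta>) - P (x n)) / (2 * \<eta>) + real (card S) / (2 * real H)"
    unfolding c by (simp add: sum.distrib sum_divide_distrib[symmetric] sum_subtractf)
  also have "- (\<Sum>n\<in>S. P (x n + - \<eta>) - P (x n)) / (2 * \<eta>) \<le> \<bar>\<Sum>n\<in>S. P (x n + - \<eta>) - P (x n)\<bar> / (2 * \<eta>)"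
    using \<eta> by (intro divide_right_mono) auto
  finally have up: "(\<Sum>n\<in>S. frac (x n) - 1 / 2) \<le> 2 * K * sqrt (real H) + real (card S) / (2 * real H)"
    using D[of "- \<eta>"] \<eta> by simp
  have "\<bar>\<Sum>n\<in>S. P (x n + \<eta>) - P (x n)\<bar> / (2 * \<eta>) \<ge> - (\<Sum>n\<in>S. P (x n + \<eta>) - P (x n)) / (2 * \<eta>)"
    using \<eta> by (intro divide_right_mono) auto
  then have "- (2 * K * sqrt (real H) + real (card S) / (2 * real H)) \<le>
      (\<Sum>n\<in>S. P (x n + \<eta>) - P (x n)) / (2 * \<eta>) - real (card S) / (2 * real H)"
    using D[of \<eta>] \<eta> by simp
  also have "\<dots> = (\<Sum>n\<in>S. (P (x n + \<eta>) - P (x n)) / (2 * \<eta>) - \<eta> / 2)"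
    unfolding c by (simp add: sum_subtractf sum_divide_distrib[symmetric])
  also have "\<dots> \<le> (\<Sum>n\<in>S. frac (x n) - 1 / 2)"
    unfolding P_def by (intro sum_mono sawtooth_le_difference_quotient \<eta>)
  finally show ?thesis using up by linarith
qed

lemma sawtooth_sum_arc_le:
  fixes F \<sigma> :: "real \<Rightarrow> real" and k H :: nat
  assumes \<mu>: "\<mu> > 0" "real k * \<mu> \<le> 1" and H: "H \<ge> 1"
    and deriv: "\<And>t. 1 \<le> t \<Longrightarrow> t \<le> real k \<Longrightarrow> (F has_real_derivative - \<sigma> t) (at t)"
    and \<sigma>: "\<And>t. 1 \<le> t \<Longrightarrow> t \<le> real k \<Longrightarrow> 0 \<le> \<sigma> t \<and> \<sigma> t \<le> 1"
    and gap: "\<And>s t. 1 \<le> s \<Longrightarrow> s \<le> t \<Longrightarrow> t \<le> real k \<Longrightarrow> \<mu> * (t - s) \<le> \<sigma> t - \<sigma> s"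
  shows "\<bar>\<Sum>n=1..k. frac (F (real n)) - 1 / 2\<bar> \<le> 26 * sqrt (real H / \<mu>) + real k / (2 * real H)"
proof -
  have exp_sum: "norm (\<Sum>n\<in>{1..k}. ue (real h * F (real n))) \<le> 13 / sqrt \<mu> * sqrt (real h)" if "h \<ge> 1" for h :: nat
  proof -
    \<comment> \<open>The test wants differences that increase within [0, 1], which
      \<open>- F\<close> has; the sign change is a complex conjugation and keeps the norm.\<close>
    have "norm (\<Sum>n=1..<Suc k. ue (real h * - F (real n))) \<le> 13 * sqrt (real h / \<mu>)"
    proof (rule exp_sum_second_derivative_test[where \<mu>=\<mu>])
      show "real (Suc k - 1) \<le> 1 / \<mu>" using \<mu> by (simp add: field_simps)
    next
      fix n assume n: "1 \<le> n" "Suc n < Suc k"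
      have "\<exists>z. real n < z \<and> z < real (Suc n) \<and> F (real (Suc n)) - F (real n) = (real (Suc n) - real n) * - \<sigma> z"
        using n by (intro MVT2 deriv) auto
      then obtain z where "real n < z" "z < real (Suc n)" "F (real (Suc n)) - F (real n) = - \<sigma> z"
        by auto
      moreover from this n have "0 \<le> \<sigma> z \<and> \<sigma> z \<le> 1" by (intro \<sigma>) auto
      ultimately show "0 \<le> - F (real (Suc n)) - - F (real n) \<and> - F (real (Suc n)) - - F (real n) \<le> 1"
        by linarith
    next
      fix m n assume mn: "1 \<le> m" "m \<le> n" "Suc n < Suc k"
      define s where "s = real n - real m"
      \<comment> \<open>One mean value argument for \<open>u\<close> yields slopes at two points
        exactly \<open>s\<close> apart; two separate arguments would lose control of their
        distance.\<close>
      define u where "u t = F t - F (t + s)" for t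
      have du: "(u has_real_derivative \<sigma> (t + s) - \<sigma> t) (at t)" if "real m \<le> t" "t \<le> real (Suc m)" for t
      proof -
        have 1: "(F has_real_derivative - \<sigma> t) (at t)" using that mn by (intro deriv) auto
        have 2: "(F has_real_derivative - \<sigma> (t + s)) (at (t + s))"
          using that mn by (intro deriv) (auto simp: s_def)
        show ?thesis unfolding u_def
          using DERIV_diff[OF 1 2[unfolded DERIV_shift]] by simp
      qed
      have "\<exists>z. real m < z \<and> z < real (Suc m) \<and> u (real (Suc m)) - u (real m) = (real (Suc m) - real m) * (\<sigma> (z + s) - \<sigma> z)"
        by (intro MVT2 du) auto
      then obtain z where z: "real m < z" "z < real (Suc m)" "u (real (Suc m)) - u (real m) = \<sigma> (z + s) - \<sigma> z"
        by auto
      have "\<mu> * (z + s - z) \<le> \<sigma> (z + s) - \<sigma> z"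
        using z(1,2) mn by (intro gap) (auto simp: s_def)
      moreover have "real (Suc m) + s = real (Suc n)" "real m + s = real n" by (auto simp: s_def)
      ultimately show "\<mu> * (real n - real m)
          \<le> (- F (real (Suc n)) - - F (real n)) - (- F (real (Suc m)) - - F (real m))"
        using z(3) unfolding u_def by (simp add: s_def)
    qed (use \<mu> that in auto)
    also have "norm (\<Sum>n=1..<Suc k. ue (real h * - F (real n))) = norm (cnj (\<Sum>n=1..<Suc k. ue (real h * F (real n))))"
      by (simp add: ue_def cis_cnj del: sum.op_ivl_Suc)
    also have "\<dots> = norm (\<Sum>n\<in>{1..k}. ue (real h * F (real n)))"
      unfolding complex_mod_cnj atLeastLessThanSuc_atLeastAtMost ..
    finally show ?thesis by (simp add: real_sqrt_divide)
  qed
  have "\<bar>\<Sum>n=1..k. frac (F (real n)) - 1 / 2\<bar>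
      \<le> 2 * (13 / sqrt \<mu>) * sqrt (real H) + real (card {1..k}) / (2 * real H)"
    by (rule sawtooth_sum_le[OF H exp_sum])
  then show ?thesis by (simp add: real_sqrt_divide)
qed

section \<open>Comparing sums with integrals\<close>

lemma trapezoid_error_le:
  fixes F \<Phi> \<sigma> :: "real \<Rightarrow> real"
  assumes ab: "b = a + 1"
    and \<Phi>: "\<And>t. a \<le> t \<Longrightarrow> t \<le> b \<Longrightarrow> (\<Phi> has_real_derivative F t) (at t)"
    and F: "\<And>t. a \<le> t \<Longrightarrow> t \<le> b \<Longrightarrow> (F has_real_derivative - \<sigma> t) (at t)"
    and mono: "\<And>s t. a \<le> s \<Longrightarrow> s \<le> t \<Longrightarrow> t \<le> b \<Longrightarrow> \<sigma> s \<le> \<sigma> t"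
  shows "\<bar>\<Phi> b - \<Phi> a - (F a + F b) / 2\<bar> \<le> (\<sigma> b - \<sigma> a) / 2"
proof -
  \<comment> \<open>The trapezoid error as a function of the right endpoint. It is controlled by the
    increase of \<sigma> alone, without a second derivative of \<open>F\<close>, and such increases
    telescope over adjacent cells.\<close>
  define q where "q t = \<Phi> t - \<Phi> a - (t - a) * (F a + F t) / 2" for t
  have dq: "(q has_real_derivative (F t - F a + (t - a) * \<sigma> t) / 2) (at t)" if "a \<le> t" "t \<le> b" for t
    unfolding q_def
    by (auto intro!: derivative_eq_intros \<Phi>[OF that] F[OF that] simp: field_simps)
  have "\<exists>z. a < z \<and> z < b \<and> q b - q a = (b - a) * ((F z - F a + (z - a) * \<sigma> z) / 2)"
    using ab by (intro MVT2 dq) auto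
  then obtain z where z: "a < z" "z < b" "q b - q a = (F z - F a + (z - a) * \<sigma> z) / 2"
    using ab by auto
  have "\<exists>w. a < w \<and> w < z \<and> F z - F a = (z - a) * - \<sigma> w"
    using z by (intro MVT2 F) auto
  then obtain w where w: "a < w" "w < z" "F z - F a = (z - a) * - \<sigma> w" by blast
  have "q b - q a = (z - a) * (\<sigma> z - \<sigma> w) / 2" using z(3) w(3) by (simp add: algebra_simps)
  moreover have "0 \<le> \<sigma> z - \<sigma> w" "\<sigma> z - \<sigma> w \<le> \<sigma> b - \<sigma> a"
    using mono[of w z] mono[of z b] mono[of a w] z w by auto
  then have "\<bar>(z - a) * (\<sigma> z - \<sigma> w)\<bar> \<le> 1 * (\<sigma> b - \<sigma> a)"
    unfolding abs_mult using z ab by (intro mult_mono) auto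
  ultimately have "\<bar>q b - q a\<bar> \<le> (\<sigma> b - \<sigma> a) / 2" by (simp only: abs_divide)
  moreover have "q b - q a = \<Phi> b - \<Phi> a - (F a + F b) / 2" by (simp add: q_def ab)
  ultimately show ?thesis by simp
qed

text \<open>Slopes are asked for only in the open interval so that \<open>s = 0\<close>, where just
  continuity is supplied, is allowed.\<close>

lemma decrease_of_slope_bounds:
  fixes F \<sigma> :: "real \<Rightarrow> real"
  assumes st: "s \<le> t" and cont: "continuous_on {s..t} F"
    and deriv: "\<And>u. s < u \<Longrightarrow> u < t \<Longrightarrow> (F has_real_derivative - \<sigma> u) (at u)"
    and \<sigma>: "\<And>u. s < u \<Longrightarrow> u < t \<Longrightarrow> 0 \<le> \<sigma> u \<and> \<sigma> u \<le> 1"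
  shows "0 \<le> F s - F t" "F s - F t \<le> t - s"
proof -
  have "0 \<le> F s - F t \<and> F s - F t \<le> t - s"
  proof (cases "s = t")
    case False
    with st have "s < t" by simp
    moreover have "F differentiable (at u)" if "s < u" "u < t" for u
      using deriv[OF that] unfolding real_differentiable_def by blast
    ultimately have "\<exists>l z. s < z \<and> z < t \<and> (F has_real_derivative l) (at z) \<and> F t - F s = (t - s) * l"
      using cont by (intro MVT)
    then obtain l z where z: "s < z" "z < t" "(F has_real_derivative l) (at z)" "F t - F s = (t - s) * l" by blast
    have "l = - \<sigma> z" by (rule DERIV_unique[OF z(3) deriv[OF z(1,2)]])
    then have "F s - F t = (t - s) * \<sigma> z" using z(4) by (simp add: algebra_simps)
    then show ?thesis using \<sigma>[OF z(1,2)] st mult_left_le[of "\<sigma> z" "t - s"] by simp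
  qed simp
  then show "0 \<le> F s - F t" "F s - F t \<le> t - s" by simp_all
qed

text \<open>No slope is given at 0, so the first cell is treated apart: there \<open>F\<close> falls
  by at most 1, and the error is at most 1/2. On the other cells the errors telescope to at most
  half the range of \<sigma>.\<close>

lemma sum_trapezoid_bound:
  fixes F \<Phi> \<sigma> :: "real \<Rightarrow> real" and k :: nat
  assumes cont: "continuous_on {0..real k} F" "continuous_on {0..real k} \<Phi>"
    and \<Phi>: "\<And>t. 0 < t \<Longrightarrow> t \<le> real k \<Longrightarrow> (\<Phi> has_real_derivative F t) (at t)"
    and F: "\<And>t. 0 < t \<Longrightarrow> t \<le> real k \<Longrightarrow> (F has_real_derivative - \<sigma> t) (at t)"
    and \<sigma>: "\<And>t. 0 < t \<Longrightarrow> t \<le> real k \<Longrightarrow> 0 \<le> \<sigma> t \<and> \<sigma> t \<le> 1"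
    and mono: "\<And>s t. 0 < s \<Longrightarrow> s \<le> t \<Longrightarrow> t \<le> real k \<Longrightarrow> \<sigma> s \<le> \<sigma> t"
  shows "\<bar>(\<Sum>n=1..k. F (real n)) - (\<Phi> (real k) - \<Phi> 0) + (F 0 - F (real k)) / 2\<bar> \<le> 2"
proof -
  have diff: "\<Phi> differentiable (at t)" if "0 < t" "t \<le> real k" for t
    using \<Phi>[OF that] unfolding real_differentiable_def by blast
  have dec: "0 \<le> F s - F t" "F s - F t \<le> t - s" if "0 \<le> s" "s \<le> t" "t \<le> real k" for s t
    using that
    by (intro decrease_of_slope_bounds[where \<sigma>=\<sigma>] continuous_on_subset[OF cont(1)] F \<sigma>; simp)+
  define e where "e n = \<Phi> (real (Suc n)) - \<Phi> (real n) - (F (real n) + F (real (Suc n))) / 2" for n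
  have tele: "(\<Sum>n=1..k. F (real n)) - (\<Phi> (real k) - \<Phi> 0) + (F 0 - F (real k)) / 2 = - (\<Sum>n<k. e n)"
    by (induction k) (simp_all add: e_def field_simps)
  show ?thesis
  proof (cases "k = 0")
    case False
    then obtain K where K: "k = Suc K" by (cases k) auto
    have e0: "\<bar>e 0\<bar> \<le> 1 / 2"
    proof -
      have "\<exists>l z. 0 < z \<and> z < 1 \<and> (\<Phi> has_real_derivative l) (at z) \<and> \<Phi> 1 - \<Phi> 0 = (1 - 0) * l"
        using K by (intro MVT continuous_on_subset[OF cont(2)] diff) auto
      then obtain l z where z: "0 < z" "z < 1" "(\<Phi> has_real_derivative l) (at z)" "\<Phi> 1 - \<Phi> 0 = l" by auto
      have "l = F z" using z K by (intro DERIV_unique[OF z(3)] \<Phi>) auto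
      then show ?thesis using z dec[of 0 z] dec[of z 1] K by (simp add: e_def abs_le_iff field_simps)
    qed
    have en: "\<bar>e n\<bar> \<le> (\<sigma> (real (Suc n)) - \<sigma> (real n)) / 2" if "n \<in> {1..<k}" for n
      unfolding e_def using that
      by (intro trapezoid_error_le[where \<sigma>=\<sigma>] \<Phi> F mono) auto
    have "(\<Sum>n<k. \<bar>e n\<bar>) = \<bar>e 0\<bar> + (\<Sum>n=1..<k. \<bar>e n\<bar>)"
      using False by (simp add: lessThan_atLeast0 sum.atLeast_Suc_lessThan)
    also have "(\<Sum>n=1..<k. \<bar>e n\<bar>) \<le> (\<Sum>n=1..<k. (\<sigma> (real (Suc n)) - \<sigma> (real n)) / 2)"
      by (intro sum_mono en)
    also have "\<dots> = (\<sigma> (real k) - \<sigma> 1) / 2"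
      using sum_Suc_diff'[of 1 k "\<lambda>n. \<sigma> (real n)"] False by (simp add: sum_divide_distrib[symmetric])
    finally have le: "(\<Sum>n<k. \<bar>e n\<bar>) \<le> \<bar>e 0\<bar> + (\<sigma> (real k) - \<sigma> 1) / 2" by simp
    have "0 \<le> \<sigma> 1" "\<sigma> (real k) \<le> 1" using \<sigma>[of 1] \<sigma>[of "real k"] False by auto
    then have "\<bar>e 0\<bar> + (\<sigma> (real k) - \<sigma> 1) / 2 \<le> 1 / 2 + (1 - 0) / 2"
      by (intro add_mono divide_right_mono diff_mono e0) auto
    with le have "(\<Sum>n<k. \<bar>e n\<bar>) \<le> 2" by simp
    then show ?thesis unfolding tele abs_minus_cancel using sum_abs[of e "{..<k}"] by linarith
  qed simp
qed

section \<open>The unit curve\<close>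

definition pcurve :: "real \<Rightarrow> real \<Rightarrow> real" where
  "pcurve p x = (1 - x powr p) powr (1 / p)"

text \<open>Minus the derivative of \<open>pcurve\<close>, written as a power of a ratio that
  increases and reaches 1 on the diagonal; the bound 1 and the growth rate are read off from this
  form.\<close>

definition pslope :: "real \<Rightarrow> real \<Rightarrow> real" where
  "pslope p x = (x / pcurve p x) powr (p - 1)"

text \<open>The abscissa of the point of the curve on the diagonal. Only abscissae up to \<open>pdiag p\<close> are
  used: there the slope is at most 1, and the rest of the ball is reached by swapping coordinates.\<close>

definition pdiag :: "real \<Rightarrow> real" where
  "pdiag p = (1 / 2) powr (1 / p)"

context
  fixes p :: real
  assumes p: "1 < p" "p \<le> 2"
begin

lemma powr_le_one: "0 \<le> x \<Longrightarrow> x \<le> 1 \<Longrightarrow> x powr p \<le> 1"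
  using powr_mono2[of p x 1] p by simp

lemma pdiag_powr: "pdiag p powr p = 1 / 2"
  using p by (simp add: pdiag_def powr_powr)

lemma pdiag_bounds: "1 / 2 \<le> pdiag p" "pdiag p < 1"
proof -
  show "1 / 2 \<le> pdiag p"
    unfolding pdiag_def using powr_mono'[of "1/p" 1 "1/2::real"] p by simp
  show "pdiag p < 1"
    unfolding pdiag_def using powr_less_mono2[of "1/p" "1/2" 1] p by simp
qed

lemma pcurve_nonneg: "0 \<le> pcurve p x"
  by (simp add: pcurve_def)

lemma pcurve_le_one: "0 \<le> x \<Longrightarrow> x \<le> 1 \<Longrightarrow> pcurve p x \<le> 1"
  unfolding pcurve_def using powr_le_one[of x] powr_mono2[of "1/p" "1 - x powr p" 1] p by simp

lemma pcurve_antimono: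
  assumes "0 \<le> x" "x \<le> y" "y \<le> 1"
  shows "pcurve p y \<le> pcurve p x"
  unfolding pcurve_def using assms powr_le_one[of y] powr_mono2[of p x y] p
  by (intro powr_mono2) auto

lemma pcurve_zero: "pcurve p 0 = 1"
  using p by (simp add: pcurve_def)

lemma pcurve_pdiag: "pcurve p (pdiag p) = pdiag p"
  unfolding pcurve_def pdiag_powr by (simp add: pdiag_def)

lemma pdiag_le_pcurve: "0 \<le> x \<Longrightarrow> x \<le> pdiag p \<Longrightarrow> pdiag p \<le> pcurve p x"
  using pcurve_antimono[of x "pdiag p"] pdiag_bounds pcurve_pdiag by simp

lemma le_pcurve_iff:
  assumes "0 \<le> x" "x \<le> 1" "0 \<le> y"
  shows "y \<le> pcurve p x \<longleftrightarrow> x powr p + y powr p \<le> 1"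
proof -
  have "pcurve p x powr p = 1 - x powr p"
    unfolding pcurve_def powr_powr using powr_le_one[OF assms(1,2)] p by simp
  moreover have "y \<le> pcurve p x \<longleftrightarrow> y powr p \<le> pcurve p x powr p"
    using p assms pcurve_nonneg powr_mono2[of p y "pcurve p x"] powr_less_mono2[of p "pcurve p x" y]
    by (meson linorder_not_le less_le_trans not_le zero_less_one order_less_trans less_imp_le)
  ultimately show ?thesis by linarith
qed

lemma continuous_on_pcurve: "continuous_on {0..1} (pcurve p)"
  unfolding pcurve_def using p powr_le_one
  by (intro continuous_on_powr' continuous_intros) auto

lemma integrable_on_pcurve: "x \<le> 1 \<Longrightarrow> pcurve p integrable_on {0..x}"
  by (intro integrable_continuous_interval continuous_on_subset[OF continuous_on_pcurve]) auto

lemma has_derivative_pcurve: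
  assumes "0 < x" "x \<le> pdiag p"
  shows "(pcurve p has_real_derivative - pslope p x) (at x)"
proof -
  have x1: "x powr p < 1" using powr_less_mono2[of p x 1] assms p pdiag_bounds by simp
  have "(pcurve p has_real_derivative (1 / p) * (1 - x powr p) powr (1 / p - 1) * (- (p * x powr (p - 1)))) (at x)"
    unfolding pcurve_def using x1 assms p
    by (auto intro!: derivative_eq_intros DERIV_fun_powr[where r="1/p", simplified])
  also have "(1 / p) * (1 - x powr p) powr (1 / p - 1) * (- (p * x powr (p - 1)))
      = - (x powr (p - 1) * (1 - x powr p) powr (1 / p - 1))" using p by simp
  also have "(1 - x powr p) powr (1 / p - 1) = 1 / pcurve p x powr (p - 1)"
  proof -
    have "1 / p - 1 = - (1 / p * (p - 1))" using p by (simp add: field_simps)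
    then show ?thesis by (simp add: pcurve_def powr_powr powr_minus_divide)
  qed
  also have "- (x powr (p - 1) * (1 / pcurve p x powr (p - 1))) = - pslope p x"
    using assms pcurve_nonneg by (simp add: pslope_def powr_divide)
  finally show ?thesis .
qed

lemma pslope_bounds:
  assumes "0 < x" "x \<le> pdiag p"
  shows "0 \<le> pslope p x" "pslope p x \<le> 1"
proof -
  have "x / pcurve p x \<le> 1" using pdiag_le_pcurve[of x] assms by simp
  then show "0 \<le> pslope p x" "pslope p x \<le> 1"
    using powr_mono2[of "p - 1" "x / pcurve p x" 1] assms p pcurve_nonneg by (simp_all add: pslope_def)
qed

text \<open>The ratio of x to \<open>pcurve p x\<close> grows at least as fast as x, because the
  curve decreases and stays at most 1. Below the diagonal the ratio is at most 1, where t^(p-1) has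
  derivative (p-1) t^(p-2), at least p - 1 because p is at most 2.\<close>

lemma pslope_gap:
  assumes "0 < x" "x \<le> y" "y \<le> pdiag p"
  shows "(p - 1) * (y - x) \<le> pslope p y - pslope p x"
proof (cases "x = y")
  case False
  with assms have xy: "x < y" by simp
  define u v where "u = x / pcurve p x" and "v = y / pcurve p y"
  have f: "0 < pcurve p y" "pcurve p y \<le> pcurve p x" "pcurve p x \<le> 1" "y \<le> pcurve p y"
    using pdiag_le_pcurve[of y] pcurve_antimono[of x y] pcurve_le_one[of x] assms pdiag_bounds by auto
  have "y - x \<le> (y - x) / pcurve p x" using divide_left_mono[of "pcurve p x" 1 "y - x"] f xy by simp
  also have "\<dots> \<le> v - u"
    unfolding u_def v_def diff_divide_distrib using f assms xy
    by (intro diff_mono divide_left_mono) auto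
  finally have uv: "y - x \<le> v - u" .
  have u0: "0 < u" using f assms by (simp add: u_def)
  have v1: "v \<le> 1" using f by (simp add: v_def)
  have "\<exists>z. u < z \<and> z < v \<and> v powr (p - 1) - u powr (p - 1) = (v - u) * ((p - 1) * z powr (p - 1 - 1))"
    using uv xy u0 by (intro MVT2 has_real_derivative_powr) auto
  then obtain z where z: "u < z" "z < v" "v powr (p - 1) - u powr (p - 1) = (v - u) * ((p - 1) * z powr (p - 1 - 1))"
    by blast
  have "1 \<le> z powr (p - 1 - 1)"
    using powr_mono2'[of "p - 1 - 1" z 1] z u0 v1 p by simp
  then have "(v - u) * ((p - 1) * 1) \<le> (v - u) * ((p - 1) * z powr (p - 1 - 1))"
    using uv xy p by (intro mult_left_mono) auto
  moreover have "(p - 1) * (y - x) \<le> (p - 1) * (v - u)" using uv p by (intro mult_left_mono) auto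
  ultimately show ?thesis using z(3) by (simp add: pslope_def u_def v_def mult.commute)
qed simp

section \<open>Columns, symmetry and the inscribed square of the ball\<close>

lemma mem_Bp_iff: "(x, y) \<in> Bp p \<longleftrightarrow> \<bar>x\<bar> powr p + \<bar>y\<bar> powr p \<le> 1"
  by (simp add: Bp_def)

lemma mem_Bp_column_iff:
  assumes "\<bar>x\<bar> \<le> pdiag p"
  shows "(x, y) \<in> Bp p \<longleftrightarrow> \<bar>y\<bar> \<le> pcurve p \<bar>x\<bar>"
  using assms pdiag_bounds by (simp add: mem_Bp_iff le_pcurve_iff)

text \<open>Beyond the diagonal abscissa each coordinate contributes more than 1/2. With
  \<open>square_subset_Bp\<close> this prepares inclusion-exclusion: two mirror-image strips cover
  the ball and meet in a square.\<close>

lemma mem_Bp_near_axis: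
  assumes "(x, y) \<in> Bp p"
  shows "\<bar>x\<bar> \<le> pdiag p \<or> \<bar>y\<bar> \<le> pdiag p"
proof (rule ccontr)
  assume "\<not> ?thesis"
  then have "pdiag p powr p < \<bar>x\<bar> powr p" "pdiag p powr p < \<bar>y\<bar> powr p"
    using p pdiag_bounds by (auto intro!: powr_less_mono2)
  with assms show False by (simp add: mem_Bp_iff pdiag_powr)
qed

lemma square_subset_Bp:
  assumes "\<bar>x\<bar> \<le> pdiag p" "\<bar>y\<bar> \<le> pdiag p"
  shows "(x, y) \<in> Bp p"
  using assms pdiag_le_pcurve[of "\<bar>x\<bar>"] by (simp add: mem_Bp_column_iff)

lemma Bp_swap: "(x, y) \<in> Bp p \<longleftrightarrow> (y, x) \<in> Bp p"
  by (simp add: mem_Bp_iff add.commute)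

end

section \<open>Lattice count and area\<close>

lemma sum_abs_symmetric_interval:
  fixes g :: "real \<Rightarrow> int"
  shows "(\<Sum>m\<in>{- int k..int k}. g \<bar>of_int m\<bar>) = g 0 + 2 * (\<Sum>n=1..k. g (real n))"
proof (induction k)
  case (Suc k)
  have "{- int (Suc k)..int (Suc k)} = insert (int (Suc k)) (insert (- int (Suc k)) {- int k..int k})"
    by auto
  with Suc show ?case by (simp add: add.commute)
qed simp

text \<open>The columns with abscissa between -k and k and their mirror image cover all lattice
  points of the dilated ball. The points counted twice are those of a full square with 2k + 1 points
  per side.\<close>

lemma lattice_count_eq_columns:
  fixes p r :: real and k :: nat
  assumes p: "1 < p" "p \<le> 2" and r: "r > 0"
    and k: "real k \<le> r * pdiag p" "r * pdiag p < real k + 1"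
  shows "int (lattice_count p r) =
    2 * ((2 * \<lfloor>r * pcurve p 0\<rfloor> + 1) + 2 * (\<Sum>n=1..k. 2 * \<lfloor>r * pcurve p (real n / r)\<rfloor> + 1)) - (2 * int k + 1)\<^sup>2"
proof -
  define Z where "Z = {(m, n). (of_int m / r, of_int n / r) \<in> Bp p}"
  define h where "h t = \<lfloor>r * pcurve p (t / r)\<rfloor>" for t
  define U where "U = (SIGMA m:{- int k..int k}. {- h \<bar>of_int m\<bar>..h \<bar>of_int m\<bar>})"
  define W where "W = {- int k..int k} \<times> {- int k..int k}"
  have h0: "0 \<le> h t" for t using r pcurve_nonneg[OF p] by (simp add: h_def)
  have kle: "\<bar>of_int m / r\<bar> \<le> pdiag p \<longleftrightarrow> m \<in> {- int k..int k}" for m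
  proof -
    have "\<bar>of_int m / r\<bar> \<le> pdiag p \<longleftrightarrow> real_of_int \<bar>m\<bar> \<le> r * pdiag p"
      using r by (simp add: field_simps)
    also have "\<dots> \<longleftrightarrow> \<bar>m\<bar> \<le> int k" using k by linarith
    finally show ?thesis by auto
  qed
  have col: "(m, n) \<in> Z \<longleftrightarrow> n \<in> {- h \<bar>of_int m\<bar>..h \<bar>of_int m\<bar>}" if "m \<in> {- int k..int k}" for m n
  proof -
    have "(m, n) \<in> Z \<longleftrightarrow> \<bar>of_int n / r\<bar> \<le> pcurve p \<bar>of_int m / r\<bar>"
      unfolding Z_def using mem_Bp_column_iff[OF p, of "of_int m / r"] kle that by simp
    also have "\<dots> \<longleftrightarrow> real_of_int \<bar>n\<bar> \<le> r * pcurve p (\<bar>of_int m\<bar> / r)"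
      using r by (simp add: field_simps)
    also have "\<dots> \<longleftrightarrow> \<bar>n\<bar> \<le> h \<bar>of_int m\<bar>" by (simp only: h_def le_floor_iff)
    finally show ?thesis by auto
  qed
  have swap: "(m, n) \<in> Z \<longleftrightarrow> (n, m) \<in> Z" for m n
    using Bp_swap[OF p] by (simp add: Z_def)
  have inU: "(m, n) \<in> U \<longleftrightarrow> m \<in> {- int k..int k} \<and> (m, n) \<in> Z" for m n
    unfolding U_def using col[of m n] by (simp only: mem_Sigma_iff) blast
  have inV: "(m, n) \<in> prod.swap ` U \<longleftrightarrow> n \<in> {- int k..int k} \<and> (m, n) \<in> Z" for m n
    using inU[of n m] swap[of m n] by (force simp: image_iff)
  have near: "m \<in> {- int k..int k} \<or> n \<in> {- int k..int k}" if "(m, n) \<in> Z" for m n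
    using mem_Bp_near_axis[OF p, of "of_int m / r" "of_int n / r"] that unfolding Z_def kle by simp
  have square: "(m, n) \<in> Z" if "m \<in> {- int k..int k}" "n \<in> {- int k..int k}" for m n
    using square_subset_Bp[OF p, of "of_int m / r" "of_int n / r"] that unfolding Z_def kle by simp
  have ZU: "Z = U \<union> prod.swap ` U"
  proof (rule set_eqI, clarify)
    fix m n show "(m, n) \<in> Z \<longleftrightarrow> (m, n) \<in> U \<union> prod.swap ` U"
      using near unfolding Un_iff inU inV by blast
  qed
  have UV: "U \<inter> prod.swap ` U = W"
  proof (rule set_eqI, clarify)
    fix m n show "(m, n) \<in> U \<inter> prod.swap ` U \<longleftrightarrow> (m, n) \<in> W"
      using square unfolding Int_iff inU inV W_def mem_Times_iff fst_conv snd_conv by blast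
  qed
  have finU: "finite U" by (simp add: U_def)
  have "card U = (\<Sum>m\<in>{- int k..int k}. nat (2 * h \<bar>of_int m\<bar> + 1))"
    unfolding U_def by (subst card_SigmaI) (auto intro!: sum.cong simp: h0)
  then have "int (card U) = (\<Sum>m\<in>{- int k..int k}. 2 * h \<bar>of_int m\<bar> + 1)"
    using h0 by (simp add: add_nonneg_nonneg)
  also have "\<dots> = (2 * h 0 + 1) + 2 * (\<Sum>n=1..k. 2 * h (real n) + 1)"
    by (rule sum_abs_symmetric_interval[where g="\<lambda>t. 2 * h t + 1"])
  finally have cU: "int (card U) = (2 * h 0 + 1) + 2 * (\<Sum>n=1..k. 2 * h (real n) + 1)" .
  have cV: "card (prod.swap ` U) = card U" by (rule card_image) simp
  have cW: "int (card W) = (2 * int k + 1)\<^sup>2"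
    by (simp add: W_def power2_eq_square nat_add_distrib algebra_simps)
  have "card Z + card W = card U + card (prod.swap ` U)"
    unfolding ZU UV[symmetric] using finU by (subst card_Un_Int) auto
  moreover have "lattice_count p r = card Z"
  proof -
    have "(\<int> \<times> \<int>) \<inter> (\<lambda>v. r *\<^sub>R v) ` Bp p = (\<lambda>(m, n). (of_int m, of_int n)) ` Z"
    proof (intro equalityI subsetI)
      fix v :: "real \<times> real" assume "v \<in> (\<int> \<times> \<int>) \<inter> (\<lambda>v. r *\<^sub>R v) ` Bp p"
      then obtain w where w: "w \<in> Bp p" "v = r *\<^sub>R w" and v: "fst v \<in> \<int>" "snd v \<in> \<int>"
        by (auto simp: mem_Times_iff)
      from v obtain m n where mn: "fst v = of_int m" "snd v = of_int n" by (auto elim!: Ints_cases)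
      have "w = (of_int m / r, of_int n / r)" using w(2) mn r by (auto simp: prod_eq_iff)
      then have "(m, n) \<in> Z" using w(1) by (simp add: Z_def)
      moreover have "v = (of_int m, of_int n)" using mn by (simp add: prod_eq_iff)
      ultimately show "v \<in> (\<lambda>(m, n). (of_int m, of_int n)) ` Z" by force
    next
      fix v :: "real \<times> real" assume "v \<in> (\<lambda>(m, n). (of_int m, of_int n)) ` Z"
      then obtain m n where v: "v = (of_int m, of_int n)" "(of_int m / r, of_int n / r) \<in> Bp p"
        by (auto simp: Z_def)
      then have "v = r *\<^sub>R (of_int m / r, of_int n / r)" using r by simp
      with v(2) have "v \<in> (\<lambda>v. r *\<^sub>R v) ` Bp p" by blast
      with v(1) show "v \<in> (\<int> \<times> \<int>) \<inter> (\<lambda>v. r *\<^sub>R v) ` Bp p" by simp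
    qed
    moreover have "inj_on (\<lambda>(m, n). (real_of_int m, real_of_int n)) Z" by (auto simp: inj_on_def)
    ultimately show ?thesis by (simp add: lattice_count_def card_image)
  qed
  ultimately show ?thesis using cU cV cW by (simp add: h_def)
qed

text \<open>The same inclusion-exclusion for area: each strip has area four times the integral, and
  the overlap is a square of side \<open>2 * pdiag p\<close>.\<close>

lemma measure_Bp:
  assumes p: "1 < p" "p \<le> 2"
  shows "measure lborel (Bp p) = 8 * integral {0..pdiag p} (pcurve p) - 4 * (pdiag p)\<^sup>2"
proof -
  define c where "c = pdiag p"
  have c: "0 < c" using pdiag_bounds[OF p] by (simp add: c_def)
  have closed: "closed (Bp p)"
  proof -
    have "Bp p = {v. \<bar>fst v\<bar> powr p + \<bar>snd v\<bar> powr p \<le> 1}" by (auto simp: Bp_def)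
    also have "closed \<dots>"
      using p by (intro closed_Collect_le continuous_intros continuous_on_powr') auto
    finally show ?thesis .
  qed
  define S where "S = {-c..c} \<times> (UNIV :: real set)"
  define T where "T = (UNIV :: real set) \<times> {-c..c}"
  define U where "U = Bp p \<inter> S"
  define V where "V = Bp p \<inter> T"
  define I where "I = integral {0..c} (pcurve p)"
  have meas: "U \<in> sets borel" "V \<in> sets borel"
    unfolding U_def V_def S_def T_def
    by (intro borel_closed closed_Int closed closed_Times; simp)+
  have "emeasure lborel U = (\<integral>\<^sup>+x. emeasure lborel (Pair x -` U) \<partial>lborel)"
  proof -
    have "U \<in> sets (lborel \<Otimes>\<^sub>M lborel)" unfolding lborel_prod using meas by simp
    from lborel.emeasure_pair_measure_alt[OF this] show ?thesis unfolding lborel_prod .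
  qed
  also have "\<dots> = (\<integral>\<^sup>+x. ennreal (2 * pcurve p \<bar>x\<bar> * indicator {-c..c} x) \<partial>lborel)"
  proof (rule nn_integral_cong)
    fix x :: real
    have "Pair x -` U = (if x \<in> {-c..c} then {- pcurve p \<bar>x\<bar>..pcurve p \<bar>x\<bar>} else {})"
      using mem_Bp_column_iff[OF p, of x] by (auto simp: U_def S_def c_def)
    then show "emeasure lborel (Pair x -` U) = ennreal (2 * pcurve p \<bar>x\<bar> * indicator {-c..c} x)"
      using pcurve_nonneg[OF p, of "\<bar>x\<bar>"] by (auto simp: indicator_def)
  qed
  also have "\<dots> = ennreal (4 * I)"
  proof (rule nn_integral_has_integral_lborel)
    show "(\<lambda>x. 2 * pcurve p \<bar>x\<bar> * indicator {-c..c} x) \<in> borel_measurable borel"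
      unfolding pcurve_def by measurable
    show "0 \<le> 2 * pcurve p \<bar>x\<bar> * indicator {-c..c} x" for x
      using pcurve_nonneg[OF p] by (simp add: indicator_def)
    have 1: "(pcurve p has_integral I) {0..c}"
      unfolding I_def c_def using pdiag_bounds[OF p] by (intro integrable_integral integrable_on_pcurve p) auto
    have "((\<lambda>x. pcurve p \<bar>x\<bar>) has_integral I) {0..c}"
      by (rule has_integral_eq[OF _ 1]) simp
    moreover from this have "((\<lambda>x. pcurve p \<bar>x\<bar>) has_integral I) {-c..0}"
      using has_integral_reflect_real[of "\<lambda>x. pcurve p \<bar>x\<bar>" I 0 "-c"] by simp
    ultimately have "((\<lambda>x. pcurve p \<bar>x\<bar>) has_integral (I + I)) {-c..c}"
      using c by (intro has_integral_combine[of "-c" 0 c]) auto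
    from has_integral_mult_right[OF this, of 2]
    have "((\<lambda>x. 2 * pcurve p \<bar>x\<bar>) has_integral (4 * I)) {-c..c}" by simp
    then have "((\<lambda>x. if x \<in> {-c..c} then 2 * pcurve p \<bar>x\<bar> else 0) has_integral (4 * I)) UNIV"
      by (simp only: has_integral_restrict_UNIV)
    also have "(\<lambda>x. if x \<in> {-c..c} then 2 * pcurve p \<bar>x\<bar> else 0) = (\<lambda>x. 2 * pcurve p \<bar>x\<bar> * indicator {-c..c} x)"
      by (auto simp: indicator_def)
    finally show "((\<lambda>x. 2 * pcurve p \<bar>x\<bar> * indicator {-c..c} x) has_integral (4 * I)) UNIV" .
  qed
  finally have eU: "emeasure lborel U = ennreal (4 * I)" .
  have eV: "emeasure lborel V = emeasure lborel U"
  proof -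
    have "(\<lambda>(x, y). (y, x)) -` U = V"
      using Bp_swap[OF p] by (auto simp: U_def V_def S_def T_def)
    moreover have "emeasure (lborel \<Otimes>\<^sub>M lborel) U =
        emeasure (lborel \<Otimes>\<^sub>M lborel) ((\<lambda>(x, y). (y, x)) -` U \<inter> space (lborel \<Otimes>\<^sub>M lborel))"
    proof -
      have U: "U \<in> sets (lborel \<Otimes>\<^sub>M lborel)" unfolding lborel_prod using meas by simp
      show ?thesis
        using arg_cong[OF lborel_pair.distr_pair_swap, of "\<lambda>M. emeasure M U"]
        unfolding emeasure_distr[OF measurable_pair_swap' U] .
    qed
    ultimately show ?thesis by (simp add: lborel_prod)
  qed
  have I0: "0 \<le> I" unfolding I_def using pcurve_nonneg[OF p]
    pdiag_bounds[OF p] by (intro integral_nonneg integrable_on_pcurve p) (auto simp: c_def)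
  have mU: "measure lborel U = 4 * I" "measure lborel V = 4 * I"
    using eU eV I0 by (simp_all add: measure_def)
  have UV: "U \<union> V = Bp p"
    using mem_Bp_near_axis[OF p] by (force simp: U_def V_def S_def T_def c_def)
  have "U \<inter> V = cbox (-c, -c) (c, c)"
    using square_subset_Bp[OF p] by (force simp: U_def V_def S_def T_def c_def cbox_Pair_eq)
  then have "measure lborel (U \<inter> V) = 4 * c\<^sup>2"
    using c content_cbox_if[of "(-c, -c)" "(c, c)"] by (simp add: content_Pair power2_eq_square)
  moreover have "measure lborel (U \<union> V) = measure lborel U + measure lborel V - measure lborel (U \<inter> V)"
    using meas eU eV by (intro measure_Un3) (auto simp: fmeasurable_def)
  ultimately show ?thesis using mU UV by (simp add: I_def c_def)
qed

section \<open>The discrepancy at scale r\<close>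

lemma has_derivative_scaled_pcurve:
  assumes p: "1 < p" "p \<le> 2" and r: "r > 0" and t: "0 < t" "t \<le> r * pdiag p"
  shows "((\<lambda>t. r * pcurve p (t / r)) has_real_derivative - pslope p (t / r)) (at t)"
proof -
  have "0 < t / r" "t / r \<le> pdiag p" using t r by (simp_all add: field_simps)
  from has_derivative_pcurve[OF p this]
  have "((\<lambda>t. pcurve p (t / r)) has_real_derivative - pslope p (t / r) * (1 / r)) (at t)"
    by (rule DERIV_chain2) (use r in \<open>auto intro!: derivative_eq_intros\<close>)
  from DERIV_cmult[OF this, of r] show ?thesis using r by simp
qed

text \<open>Slopes are unchanged by dilation while abscissae gain a factor r, so the growth rate p -
  1 becomes (p-1)/r.\<close>

lemma scaled_pslope:
  assumes p: "1 < p" "p \<le> 2" and r: "r > 0" and t: "0 < t" "t \<le> r * pdiag p"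
  shows "0 \<le> pslope p (t / r) \<and> pslope p (t / r) \<le> 1"
    and "0 < s \<Longrightarrow> s \<le> t \<Longrightarrow> (p - 1) / r * (t - s) \<le> pslope p (t / r) - pslope p (s / r)"
proof -
  have t': "0 < t / r" "t / r \<le> pdiag p" using t r by (simp_all add: field_simps)
  then show "0 \<le> pslope p (t / r) \<and> pslope p (t / r) \<le> 1"
    using pslope_bounds[OF p] by simp
  assume s: "0 < s" "s \<le> t"
  then have "(p - 1) * (t / r - s / r) \<le> pslope p (t / r) - pslope p (s / r)"
    using t' r by (intro pslope_gap p) (auto simp: divide_right_mono)
  moreover have "(p - 1) / r * (t - s) = (p - 1) * (t / r - s / r)"
    unfolding diff_divide_distrib[symmetric] by simp
  ultimately show "(p - 1) / r * (t - s) \<le> pslope p (t / r) - pslope p (s / r)" by simp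
qed

text \<open>The delicate point is that k is an integer while the area formula stops at the diagonal
  abscissa \<open>c\<close>. All terms of order r must cancel exactly, and they do because the curve
  meets the diagonal at height \<open>c\<close>.\<close>

lemma discrepancy_le_sawtooth_sum:
  fixes p r :: real and k :: nat
  assumes p: "1 < p" "p \<le> 2" and r: "r > 0"
    and k: "real k \<le> r * pdiag p" "r * pdiag p < real k + 1"
  shows "discrepancy p r \<le> 31 + 8 * \<bar>\<Sum>n=1..k. frac (r * pcurve p (real n / r)) - 1 / 2\<bar>"
proof -
  define c where "c = r * pdiag p"
  define F where "F t = r * pcurve p (t / r)" for t
  define \<sigma> where "\<sigma> t = pslope p (t / r)" for t
  \<comment> \<open>This is the integral of \<open>F\<close> from 0 to t, kept at unit scale so that
    \<open>\<Phi> c\<close> matches \<open>measure_Bp\<close>.\<close>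
  define \<Phi> where "\<Phi> t = r\<^sup>2 * integral {0..t / r} (pcurve p)" for t
  have c: "real k \<le> c" "c < real k + 1" using k by (simp_all add: c_def)
  have cr: "c < r" using pdiag_bounds[OF p] r by (simp add: c_def)
  have scaled_image: "(\<lambda>t. t / r) ` {0..r} \<subseteq> {0..1}" using r by auto
  have cF: "continuous_on {0..r} F"
    unfolding F_def
    by (intro continuous_intros continuous_on_compose2[OF continuous_on_pcurve[OF p] _ scaled_image]) (use r in auto)
  have c\<Phi>: "continuous_on {0..r} \<Phi>"
    unfolding \<Phi>_def
    by (intro continuous_intros
        continuous_on_compose2[OF indefinite_integral_continuous_1[OF integrable_on_pcurve[OF p order.refl]] _ scaled_image])
      (use r in auto)
  have d\<Phi>: "(\<Phi> has_real_derivative F t) (at t)" if "0 < t" "t < r" for t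
  proof -
    have t': "0 < t / r" "t / r < 1" using that r by simp_all
    have "((\<lambda>u. integral {0..u} (pcurve p)) has_real_derivative pcurve p (t / r)) (at (t / r) within {0..1})"
      using t' by (intro integral_has_real_derivative continuous_on_pcurve p) auto
    then have "((\<lambda>u. integral {0..u} (pcurve p)) has_real_derivative pcurve p (t / r)) (at (t / r))"
      using t' by (simp add: at_within_Icc_at)
    then have "((\<lambda>t. integral {0..t / r} (pcurve p)) has_real_derivative pcurve p (t / r) * (1 / r)) (at t)"
      by (rule DERIV_chain2) (use r in \<open>auto intro!: derivative_eq_intros\<close>)
    from DERIV_cmult[OF this, of "r\<^sup>2"] show ?thesis
      using r unfolding \<Phi>_def F_def by (simp add: power2_eq_square)
  qed
  have dF: "(F has_real_derivative - \<sigma> t) (at t)" if "0 < t" "t \<le> c" for t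
    unfolding F_def \<sigma>_def using that by (intro has_derivative_scaled_pcurve p r) (auto simp: c_def)
  have \<sigma>: "0 \<le> \<sigma> t \<and> \<sigma> t \<le> 1" if "0 < t" "t \<le> c" for t
    unfolding \<sigma>_def using that by (intro scaled_pslope p r) (auto simp: c_def)
  have \<sigma>mono: "\<sigma> s \<le> \<sigma> t" if "0 < s" "s \<le> t" "t \<le> c" for s t
  proof -
    have "0 \<le> (p - 1) / r * (t - s)" using that r p by simp
    also have "\<dots> \<le> \<sigma> t - \<sigma> s"
      unfolding \<sigma>_def using that by (intro scaled_pslope p r) (auto simp: c_def)
    finally show ?thesis by simp
  qed
  have dec: "0 \<le> F s - F t" "F s - F t \<le> t - s" if "0 \<le> s" "s \<le> t" "t \<le> c" for s t
    using that cr
    by (intro decrease_of_slope_bounds[where \<sigma>=\<sigma>] continuous_on_subset[OF cF] dF \<sigma>; simp)+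
  have F0: "F 0 = r" and Fc: "F c = c"
    using r pcurve_zero[OF p] pcurve_pdiag[OF p] by (simp_all add: F_def c_def)
  define \<theta> where "\<theta> = c - real k"
  have \<theta>: "0 \<le> \<theta>" "\<theta> \<le> 1" using c by (simp_all add: \<theta>_def)
  define e1 where "e1 = (\<Sum>n=1..k. F (real n)) - (\<Phi> (real k) - \<Phi> 0) + (F 0 - F (real k)) / 2"
  have e1: "\<bar>e1\<bar> \<le> 2"
    unfolding e1_def
    by (rule sum_trapezoid_bound[where \<sigma>=\<sigma>])
      (use c cr in \<open>auto intro!: continuous_on_subset[OF cF] continuous_on_subset[OF c\<Phi>] d\<Phi> dF \<sigma>mono simp: \<sigma>\<close>)
  \<comment> \<open>Between k and \<open>c\<close> the height differs from \<open>c\<close> by at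
    most 1, so the missing strip has area \<theta> c up to O(1).\<close>
  define e2 where "e2 = \<Phi> (real k) - \<Phi> c + \<theta> * c"
  have e2: "\<bar>e2\<bar> \<le> 1"
  proof (cases "\<theta> = 0")
    case False
    then have kc: "real k < c" using \<theta> by (simp add: \<theta>_def)
    have "\<Phi> differentiable (at u)" if "real k < u" "u < c" for u
      using d\<Phi>[of u] that cr unfolding real_differentiable_def by force
    then have "\<exists>l z. real k < z \<and> z < c \<and> (\<Phi> has_real_derivative l) (at z) \<and> \<Phi> c - \<Phi> (real k) = (c - real k) * l"
      using kc cr by (intro MVT continuous_on_subset[OF c\<Phi>]) auto
    then obtain l z where z: "real k < z" "z < c" "(\<Phi> has_real_derivative l) (at z)" "\<Phi> c - \<Phi> (real k) = (c - real k) * l"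
      by blast
    have "l = F z" using z cr by (intro DERIV_unique[OF z(3)] d\<Phi>) auto
    then have "e2 = - \<theta> * (F z - F c)" using z(4) Fc by (simp add: e2_def \<theta>_def algebra_simps)
    moreover have "\<bar>\<theta> * (F z - F c)\<bar> \<le> 1 * 1"
      unfolding abs_mult using dec[of z c] z \<theta> c by (intro mult_mono) auto
    ultimately show ?thesis by simp
  qed (simp add: e2_def \<theta>_def)
  define e3 where "e3 = F (real k) - c"
  have e3: "0 \<le> e3" "e3 \<le> 1" using dec[of "real k" c] c Fc by (simp_all add: e3_def)
  define \<Psi> where "\<Psi> = (\<Sum>n=1..k. frac (F (real n)) - 1 / 2)"
  have "(\<Sum>n=1..k. 2 * real_of_int \<lfloor>F (real n)\<rfloor> + 1) = (\<Sum>n=1..k. 2 * F (real n) - 2 * (frac (F (real n)) - 1 / 2))"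
    by (intro sum.cong) (simp_all add: frac_def)
  also have "\<dots> = 2 * (\<Sum>n=1..k. F (real n)) - 2 * \<Psi>"
    unfolding \<Psi>_def sum_distrib_left by (rule sum_subtractf)
  finally have floors: "(\<Sum>n=1..k. 2 * real_of_int \<lfloor>F (real n)\<rfloor> + 1) = 2 * (\<Sum>n=1..k. F (real n)) - 2 * \<Psi>" .
  have "real (lattice_count p r) = real_of_int (int (lattice_count p r))" by simp
  also have "\<dots> = 2 * ((2 * real_of_int \<lfloor>F 0\<rfloor> + 1) + 2 * (\<Sum>n=1..k. 2 * real_of_int \<lfloor>F (real n)\<rfloor> + 1)) - (2 * real k + 1)\<^sup>2"
    unfolding lattice_count_eq_columns[OF p r k] by (simp add: F_def)
  also have "\<dots> = 4 * r - 4 * (frac r - 1 / 2) + 8 * (\<Sum>n=1..k. F (real n)) - 8 * \<Psi> - (2 * real k + 1)\<^sup>2"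
    unfolding floors F0 by (simp add: frac_def)
  finally have count: "real (lattice_count p r) =
    4 * r - 4 * (frac r - 1 / 2) + 8 * (\<Sum>n=1..k. F (real n)) - 8 * \<Psi> - (2 * real k + 1)\<^sup>2" .
  have area: "measure lborel (Bp p) * r\<^sup>2 = 8 * \<Phi> c - 4 * c\<^sup>2"
    unfolding measure_Bp[OF p] using r by (simp add: \<Phi>_def c_def algebra_simps)
  have sumF: "(\<Sum>n=1..k. F (real n)) = e1 + e2 - \<theta> * c + \<Phi> c - r / 2 + c / 2 + e3 / 2"
    using F0 by (simp add: e1_def e2_def e3_def \<Phi>_def field_simps)
  have k\<theta>: "real k = c - \<theta>" by (simp add: \<theta>_def)
  \<comment> \<open>Writing 2k + 1 as 2c + (1 - 2 \<theta>), the square contributes 4c^2 + 4c - 8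
    \<theta> c + (1 - 2 \<theta>)^2, and everything in it but the last term cancels against the area
    and the sum of heights.\<close>
  have eq: "real (lattice_count p r) - measure lborel (Bp p) * r\<^sup>2
      = - 4 * (frac r - 1 / 2) + 8 * e1 + 8 * e2 + 4 * e3 - 8 * \<Psi> - (1 - 2 * \<theta>)\<^sup>2"
    unfolding count area sumF k\<theta> by (simp add: power2_eq_square algebra_simps)
  \<comment> \<open>The constant 31 is 2 + 16 + 8 + 4 + 1, one summand for each bounded
    term.\<close>
  have combine: "\<bar>- 4 * (u - 1 / 2) + 8 * a + 8 * b + 4 * e3 - 8 * w - q\<bar> \<le> 31 + 8 * \<bar>w\<bar>"
    if "- 2 \<le> a" "a \<le> 2" "- 1 \<le> b" "b \<le> 1" "0 \<le> u" "u \<le> 1" "0 \<le> q" "q \<le> 1" for a b u w q :: real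
    using that e3 by (simp add: abs_if)
  have "discrepancy p r \<le> 31 + 8 * \<bar>\<Psi>\<bar>"
    unfolding discrepancy_def eq using \<theta> e1 e2 frac_lt_1[of r]
    by (intro combine) (simp_all add: abs_square_le_1 abs_le_iff)
  then show ?thesis by (simp add: \<Psi>_def F_def)
qed

lemma discrepancy_le:
  fixes p r :: real
  assumes p: "1 < p" "p \<le> 2" and r: "r \<ge> 1"
  shows "discrepancy p r \<le> 455 * (r powr (2 / 3) / sqrt (p - 1))"
proof -
  define k where "k = nat \<lfloor>r * pdiag p\<rfloor>"
  have "0 \<le> r * pdiag p" using r pdiag_bounds[OF p] by simp
  then have k: "real k \<le> r * pdiag p" "r * pdiag p < real k + 1"
    unfolding k_def by linarith+
  have kr: "real k \<le> r" using k(1) pdiag_bounds[OF p] r mult_left_le[of "pdiag p" r] by linarith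
  define s where "s = r powr (1 / 3)"
  have s1: "1 \<le> s" using r by (simp add: s_def ge_one_powr_ge_zero)
  have s2: "r powr (2 / 3) = s\<^sup>2" and s3: "r = s ^ 3"
    using r by (simp_all add: s_def powr_powr flip: powr_numeral)
  \<comment> \<open>Independent of p: the term k/(2H) is at most s^2 and is absorbed into
    \<open>X\<close> because p - 1 is at most 1. The bound H \<le> 2 s uses s \<ge> 1, hence r \<ge>
    1.\<close>
  define H where "H = nat \<lceil>s\<rceil>"
  have H: "s \<le> real H" "real H \<le> 2 * s" "H \<ge> 1" using s1 unfolding H_def by linarith+
  define X where "X = s\<^sup>2 / sqrt (p - 1)"
  have sX: "s\<^sup>2 \<le> X"
  proof -
    have "sqrt (p - 1) \<le> 1" "0 < sqrt (p - 1)" using p by auto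
    then show ?thesis unfolding X_def by (simp add: le_divide_eq mult_left_le)
  qed
  have "1 \<le> s\<^sup>2" using s1 by simp
  have "\<bar>\<Sum>n=1..k. frac (r * pcurve p (real n / r)) - 1 / 2\<bar>
      \<le> 26 * sqrt (real H / ((p - 1) / r)) + real k / (2 * real H)"
  proof (rule sawtooth_sum_arc_le[where \<sigma>="\<lambda>t. pslope p (t / r)"])
    show "0 < (p - 1) / r" using p r by simp
    have "real k * (p - 1) \<le> r * 1" using kr p r by (intro mult_mono) auto
    then show "real k * ((p - 1) / r) \<le> 1" using r by (simp add: field_simps)
  next
    fix t assume "1 \<le> t" "t \<le> real k"
    then have t: "0 < t" "t \<le> r * pdiag p" using k(1) by auto
    show "((\<lambda>t. r * pcurve p (t / r)) has_real_derivative - pslope p (t / r)) (at t)"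
      using r by (intro has_derivative_scaled_pcurve p t) simp
    show "0 \<le> pslope p (t / r) \<and> pslope p (t / r) \<le> 1"
      using r by (intro scaled_pslope(1) p t) simp
  next
    fix v t assume "1 \<le> v" "v \<le> t" "t \<le> real k"
    then show "(p - 1) / r * (t - v) \<le> pslope p (t / r) - pslope p (v / r)"
      using k(1) r by (intro scaled_pslope(2) p) simp_all
  qed (rule H)
  also have "sqrt (real H / ((p - 1) / r)) \<le> 2 * X"
  proof -
    have "real H / ((p - 1) / r) = real H * s ^ 3 / (p - 1)" using r s3 by simp
    also have "\<dots> \<le> (2 * s) * s ^ 3 / (p - 1)"
      using H s1 p by (intro divide_right_mono mult_right_mono) auto
    also have "\<dots> \<le> (2 * s\<^sup>2)\<^sup>2 / (p - 1)"
      using s1 p by (intro divide_right_mono) (auto simp: power2_eq_square power3_eq_cube)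
    finally have "sqrt (real H / ((p - 1) / r)) \<le> sqrt ((2 * s\<^sup>2)\<^sup>2 / (p - 1))" by simp
    also have "\<dots> = 2 * X" unfolding X_def real_sqrt_divide real_sqrt_abs by simp
    finally show ?thesis .
  qed
  also have "real k / (2 * real H) \<le> s ^ 3 / s"
    using kr s3 H s1 by (intro frac_le) auto
  also have "s ^ 3 / s = s\<^sup>2" using s1 by (simp add: power2_eq_square power3_eq_cube)
  finally have "\<bar>\<Sum>n=1..k. frac (r * pcurve p (real n / r)) - 1 / 2\<bar> \<le> 53 * X" using sX by simp
  \<comment> \<open>Here 53 = 26 * 2 + 1 and 455 = 31 + 8 * 53, using that \<open>X\<close> is at
    least 1.\<close>
  then have "discrepancy p r \<le> 455 * X"
    using discrepancy_le_sawtooth_sum[OF p _ k] r sX \<open>1 \<le> s\<^sup>2\<close> by fastforce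
  then show ?thesis by (simp add: X_def s2)
qed

(* The supremum is over r >= 1, not r > 0: for small r > 0 the origin is the only lattice
   point in r B_p, so E_p(r) / r^(2/3) tends to infinity as r tends to 0.
   It is taken in ereal so that the bound includes the finiteness of the supremum. *)
theorem proposition4p1:
  shows "\<exists>C3 :: real. \<forall>p :: real. 1 < p \<and> p \<le> 2 \<longrightarrow>
           (SUP r \<in> {1 :: real ..}. ereal (discrepancy p r / r powr (2 / 3)))
             \<le> ereal (C3 / sqrt (p - 1))"
proof (intro exI allI impI SUP_least)
  fix p r :: real assume "1 < p \<and> p \<le> 2" "r \<in> {1..}"
  then show "ereal (discrepancy p r / r powr (2 / 3)) \<le> ereal (455 / sqrt (p - 1))"
    using discrepancy_le[of p r] by (simp add: field_simps)
qed

end
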